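(* Let $M=2^m$ with $M>4$ and let $\mathbb{X}_{\mathrm{PSK}}$ be the $M$-PSK input alphabet. Then for every binary labeling $\mathbb{L}$ of order $m$, the constellation $[\mathbb{X}_{\mathrm{PSK}},\mathbb{L},\mathbb{U}_M]$ is not first-order optimal (FOO) for BICM.
   Context: $M$-PSK. The $M$-PSK input alphabet $\mathbb{X}_{\mathrm{PSK}}$ is the $M\times2$ matrix with rows $\boldsymbol{x}_i=\left[\cos\frac{(2i+1)\pi}{M},\sin\frac{(2i+1)\pi}{M}\right]$, $i=0,\ldots,M-1$ (dimension $N=2$). Constellations. A binary labeling $\mathbb{L}$ of order $m$ is an $M\times m$ matrix whose rows $\boldsymbol{c}_i=[c_{i,0},\ldots,c_{i,m-1}]$, $i=0,\ldots,M-1$, are the $M$ distinct elements of $\{0,1\}^m$. $\Omega=[\mathbb{X},\mathbb{L},\mathbb{U}_M]$, where $\mathbb{X}$ has rows $\boldsymbol{x}_0,\ldots,\boldsymbol{x}_{M-1}\in\mathbb{R}^N$, denotes the constellation in which the bits $C_0,\ldots,C_{m-1}$ are independent and uniform on $\{0,1\}$ and the transmitted symbol is $\boldsymbol{X}=\boldsymbol{x}_i$ when $[C_0,\ldots,C_{m-1}]=\boldsymbol{c}_i$. Put $E_s=\mathbb{E}[\|\boldsymbol{X}\|^2]$. Channel. $\boldsymbol{Y}=\boldsymbol{H}\circ\boldsymbol{X}+\boldsymbol{Z}$, where $\circ$ is the element-wise product, $\boldsymbol{X},\boldsymbol{H},\boldsymbol{Z}$ are mutually independent, $\boldsymbol{Z}$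 is Gaussian in $\mathbb{R}^N$ with independent zero-mean components of variance $N_0/2$, and $\boldsymbol{H}$ is a real random vector whose $N$ components (possibly dependent) all have the same distribution, that of a random variable $H$, with $0<\mathbb{E}[H^2]<\infty$. It is assumed that there is $\omega>0$ such that $\Pr\{\|\boldsymbol{H}\|^2>\Delta\}\le\exp(-\Delta^\omega)$ for all sufficiently large $\Delta>0$. $\boldsymbol{H}$ and $N_0$ are known at the receiver. Define $\mathsf{SNR}=\mathbb{E}[H^2]\,E_s/N_0$; the constellation and the law of $\boldsymbol{H}$ are fixed and $N_0$ varies over $(0,\infty)$, so $\mathsf{SNR}\to0$ means $N_0\to\infty$. BICM capacity (in bits). $\mathsf{I}^{\mathrm{BI}}_\Omega(\mathsf{SNR})=\sum_{k=0}^{m-1}\mathbb{E}\left[\log_2\frac{p_{\boldsymbol{Y}|C_k,\boldsymbol{H}}(\boldsymbol{Y})}{p_{\boldsymbol{Y}|\boldsymbol{H}}(\boldsymbol{Y})}\right]$. The coefficient $\alpha^{\mathrm{BI}}_\Omega$ is defined by $\mathsf{I}^{\mathrm{BI}}_\Omega(\mathsf{SNR})=\alpha^{\mathrm{BI}}_\Omega\,\mathsf{SNR}+O(\mathsf{SNR}^2)$ as $\mathsf{SNR}\to 0$. The constellation $\Omega$ is first-order optimal (FOO) for BICM if $\alpha^{\mathrm{BI}}_\Omega=\log_2 e$. *)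

theory Defs
  imports "HOL-Probability.Probability" "HOL-Library.Landau_Symbols"
begin

definition psk_alphabet :: "nat \<Rightarrow> nat \<Rightarrow> real^2" where
  "psk_alphabet M i =
     vector [cos ((2 * real i + 1) * pi / real M), sin ((2 * real i + 1) * pi / real M)]"

text \<open>
  A constellation consists of an alphabet \<open>X\<close> and a labeling \<open>L\<close>, of which only the values at
  indices below \<open>2 ^ m\<close> matter. The row of the label matrix with index \<open>i\<close> is the list \<open>L i\<close>.
\<close>

definition binary_labeling :: "nat \<Rightarrow> (nat \<Rightarrow> bool list) \<Rightarrow> bool" where
  "binary_labeling m L \<longleftrightarrow> bij_betw L {..<2 ^ m} {bs. length bs = m}"

definition coded_bits :: "nat \<Rightarrow> bool list pmf" where
  "coded_bits m = replicate_pmf m (bernoulli_pmf (1 / 2))"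

definition symbol ::
  "nat \<Rightarrow> (nat \<Rightarrow> real^'n) \<Rightarrow> (nat \<Rightarrow> bool list) \<Rightarrow> bool list \<Rightarrow> real^'n" where
  "symbol m X L bs = X (inv_into {..<2 ^ m} L bs)"

definition symbol_energy ::
  "nat \<Rightarrow> (nat \<Rightarrow> real^'n) \<Rightarrow> (nat \<Rightarrow> bool list) \<Rightarrow> real" where
  "symbol_energy m X L =
     measure_pmf.expectation (coded_bits m) (\<lambda>bs. (norm (symbol m X L bs))\<^sup>2)"

text \<open>
  The fading vector enters only through its law \<open>\<mu>\<close>; \<open>\<nu>\<close> is the common law of its components,
  which need not be independent.
\<close>

definition fading_law :: "(real^'n) measure \<Rightarrow> real measure \<Rightarrow> bool" where
  "fading_law \<mu> \<nu> \<longleftrightarrow>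
     prob_space \<mu> \<and> sets \<mu> = sets borel \<and>
     (\<forall>j. distr \<mu> borel (\<lambda>h. h $ j) = \<nu>) \<and>
     integrable \<nu> (\<lambda>t. t\<^sup>2) \<and> 0 < (\<integral>t. t\<^sup>2 \<partial>\<nu>) \<and>
     (\<exists>\<omega>>0. \<forall>\<^sub>F \<Delta> in at_top. measure \<mu> {h. (norm h)\<^sup>2 > \<Delta>} \<le> exp (- (\<Delta> powr \<omega>)))"

definition noise_density :: "real \<Rightarrow> real^'n \<Rightarrow> real" where
  "noise_density N0 z = (\<Prod>j\<in>UNIV. normal_density 0 (sqrt (N0 / 2)) (z $ j))"

definition noise_law :: "real \<Rightarrow> (real^'n) measure" where
  "noise_law N0 = density lborel (\<lambda>z. ennreal (noise_density N0 z))"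

text \<open>
  The conditional densities of the output \<open>y\<close> given the fading \<open>h\<close>, respectively given \<open>h\<close> and
  the event that bit \<open>k\<close> equals \<open>b\<close>, are mixtures of noise densities centred at the faded
  symbols. The product on \<^typ>\<open>real^'n\<close> is the component-wise one.
\<close>

definition output_density ::
  "nat \<Rightarrow> (nat \<Rightarrow> real^'n) \<Rightarrow> (nat \<Rightarrow> bool list) \<Rightarrow> real \<Rightarrow> real^'n \<Rightarrow> real^'n \<Rightarrow> real" where
  "output_density m X L N0 h y =
     measure_pmf.expectation (coded_bits m) (\<lambda>bs. noise_density N0 (y - h * symbol m X L bs))"

definition output_density_given_bit ::
  "nat \<Rightarrow> (nat \<Rightarrow> real^'n) \<Rightarrow> (nat \<Rightarrow> bool list) \<Rightarrow> real \<Rightarrow> nat \<Rightarrow> bool \<Rightarrow>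
     real^'n \<Rightarrow> real^'n \<Rightarrow> real" where
  "output_density_given_bit m X L N0 k b h y =
     measure_pmf.expectation (cond_pmf (coded_bits m) {bs. bs ! k = b})
       (\<lambda>bs. noise_density N0 (y - h * symbol m X L bs))"

definition bicm_capacity ::
  "nat \<Rightarrow> (nat \<Rightarrow> real^'n) \<Rightarrow> (nat \<Rightarrow> bool list) \<Rightarrow> (real^'n) measure \<Rightarrow> real \<Rightarrow> real" where
  "bicm_capacity m X L \<mu> N0 =
     (\<Sum>k<m. \<integral>(bs, h, z).
        (let y = h * symbol m X L bs + z
         in log 2 (output_density_given_bit m X L N0 k (bs ! k) h y / output_density m X L N0 h y))
        \<partial>(measure_pmf (coded_bits m) \<Otimes>\<^sub>M (\<mu> \<Otimes>\<^sub>M noise_law N0)))"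

definition snr ::
  "nat \<Rightarrow> (nat \<Rightarrow> real^'n) \<Rightarrow> (nat \<Rightarrow> bool list) \<Rightarrow> real measure \<Rightarrow> real \<Rightarrow> real" where
  "snr m X L \<nu> N0 = (\<integral>t. t\<^sup>2 \<partial>\<nu>) * symbol_energy m X L / N0"

text \<open>
  Capacity and SNR are both functions of the noise level \<open>N0\<close>, and the regime of vanishing SNR
  is \<open>N0\<close> tending to infinity. The coefficient is a definite description, so it carries no
  information unless the expansion exists; a statement that it differs from a given value can
  therefore only be proved by establishing the expansion.
\<close>

definition bicm_coeff ::
  "nat \<Rightarrow> (nat \<Rightarrow> real^'n) \<Rightarrow> (nat \<Rightarrow> bool list) \<Rightarrow> (real^'n) measure \<Rightarrow> real measure \<Rightarrow> real" where
  "bicm_coeff m X L \<mu> \<nu> =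
     (THE \<alpha>. (\<lambda>N0. bicm_capacity m X L \<mu> N0 - \<alpha> * snr m X L \<nu> N0)
              \<in> O[at_top](\<lambda>N0. (snr m X L \<nu> N0)\<^sup>2))"

definition bicm_first_order_optimal ::
  "nat \<Rightarrow> (nat \<Rightarrow> real^'n) \<Rightarrow> (nat \<Rightarrow> bool list) \<Rightarrow> (real^'n) measure \<Rightarrow> real measure \<Rightarrow> bool" where
  "bicm_first_order_optimal m X L \<mu> \<nu> \<longleftrightarrow> bicm_coeff m X L \<mu> \<nu> = log 2 (exp 1)"

end

theory Submission
  imports Defs "HOL-Real_Asymp.Real_Asymp"
begin

text \<open>
  Condition on the fading vector \<open>h\<close> and write \<open>q\<close> for its squared norm divided by \<open>N0\<close>. Dividing all
  output densities by the noise density turns them into averages \<open>G\<close> and \<open>G \<plusminus> D\<close> of exponential tilts,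
  whose mixed moments under the noise law are explicit exponentials. The information carried by one
  bit is the integral of \<open>G * F (D / G)\<close> for an even function \<open>F\<close> with
  \<open>t\<^sup>2 / 2 \<le> F t \<le> t\<^sup>2 / 2 + t ^ 4 / 3\<close>, so that it equals half the second moment of \<open>D\<close> up to
  \<open>O(q\<^sup>2)\<close>. Since the bound on the error is uniform in \<open>h\<close> and the fourth moment of the fading is
  finite, integrating over \<open>h\<close> gives the expansion of the capacity, with coefficient proportional to
  \<open>\<Sum>k. \<parallel>w k\<parallel>\<^sup>2\<close>, where the \<open>w k\<close> are the first-order Walsh coefficients of the symbol map.
  First-order optimality is then the equality case of Bessel's inequality: it forces the symbol to be
  \<open>\<Sum>k. \<plusminus> w k\<close>. As all symbols have norm one, the \<open>w k\<close> are orthogonal, and as the symbols are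
  distinct, they are nonzero. The plane contains at most two such vectors, whereas \<open>m \<ge> 3\<close>.
\<close>

section \<open>Gaussian tilts\<close>

text \<open>The ratio of the noise densities at \<open>y - a\<close> and at \<open>y\<close>.\<close>

definition tilt :: "real \<Rightarrow> real^'n \<Rightarrow> real^'n \<Rightarrow> real" where
  "tilt N0 a y = exp ((2 * (a \<bullet> y) - a \<bullet> a) / N0)"

lemma tilt_pos [simp]: "0 < tilt N0 a y"
  by (simp add: tilt_def)

text \<open>Of the exponents only the cross term of the inner product is left over, so a product of
  tilts is a constant times a tilt. All mixed moments of tilts become explicit in this way.\<close>

lemma tilt_mult: "tilt N0 a y * tilt N0 b y = exp (2 * (a \<bullet> b) / N0) * tilt N0 (a + b) y"
  unfolding tilt_def exp_add[symmetric]
  by (rule arg_cong[where f = exp])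
     (simp add: inner_add_left inner_add_right inner_commute algebra_simps add_divide_distrib diff_divide_distrib)

text \<open>Up to division by \<open>N0\<close>, the \<open>k\<close>-th power subtracts
  \<open>k * (a \<bullet> a)\<close> in the exponent, whereas the tilt by
  \<open>k *\<^sub>R a\<close> subtracts \<open>k^2 * (a \<bullet> a)\<close>; the prefactor is the
  difference.\<close>

lemma tilt_power:
  "tilt N0 a y ^ k = exp (real k * (real k - 1) * (a \<bullet> a) / N0) * tilt N0 (real k *\<^sub>R a) y"
  unfolding tilt_def exp_add[symmetric] exp_of_nat_mult[symmetric]
  by (rule arg_cong[where f = exp])
     (simp add: algebra_simps add_divide_distrib diff_divide_distrib)

lemma tilt_measurable [measurable]: "tilt N0 a \<in> borel_measurable borel"
  unfolding tilt_def by measurable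

lemma noise_density_eq:
  fixes z :: "real^'n"
  assumes "0 < N0"
  shows "noise_density N0 z = (1 / sqrt (pi * N0)) ^ CARD('n) * exp (- (z \<bullet> z) / N0)"
  using assms
  by (simp add: noise_density_def normal_density_def prod.distrib exp_sum[symmetric] inner_vec_def
      sum_divide_distrib power2_eq_square sum_negf prod_dividef power_one_over)

lemma noise_density_shift:
  assumes "0 < N0"
  shows "noise_density N0 (y - a) = noise_density N0 y * tilt N0 a y"
  using assms unfolding noise_density_eq[OF assms] tilt_def mult.assoc exp_add[symmetric]
  by (simp add: inner_diff_left inner_diff_right inner_commute field_simps)

lemma noise_density_pos: "0 < N0 \<Longrightarrow> 0 < noise_density N0 z"
  by (simp add: noise_density_eq)

lemma vec_nth_measurable: "(\<lambda>z::real^'n. z $ j) \<in> borel_measurable borel"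
  by (intro borel_measurable_continuous_onI continuous_intros)

lemma noise_density_measurable [measurable]: "noise_density N0 \<in> borel_measurable borel"
  using vec_nth_measurable[measurable] unfolding noise_density_def by measurable

lemma sets_noise_law [measurable_cong]: "sets (noise_law N0) = sets borel"
  by (simp add: noise_law_def)

lemma space_noise_law [simp]: "space (noise_law N0) = UNIV"
  by (simp add: noise_law_def)

lemma prob_space_noise_law:
  assumes "0 < N0"
  shows "prob_space (noise_law N0 :: (real^'n) measure)"
proof
  let ?f = "\<lambda>t. ennreal (normal_density 0 (sqrt (N0 / 2)) t)"
  have one: "(\<integral>\<^sup>+t. ?f t \<partial>lborel) = 1"
    using integral_normal_density[of "sqrt (N0/2)" 0] assms
      integrable_normal_density[of "sqrt (N0/2)" 0]
    by (subst nn_integral_eq_integral) auto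
  \<comment> \<open>The coordinates are re-indexed by the axis vectors, because Lebesgue measure
    factorises over \<open>Basis\<close>.\<close>
  have prod: "ennreal (noise_density N0 z) = (\<Prod>b\<in>Basis. ?f (z \<bullet> b))" for z :: "real^'n"
  proof -
    have "(\<Prod>b\<in>(Basis::(real^'n) set). ?f (z \<bullet> b)) = (\<Prod>j\<in>UNIV. ?f (z \<bullet> axis j 1))"
      by (rule prod.reindex_cong[of "\<lambda>j. axis j 1"])
         (auto simp: inj_on_def axis_eq_axis Basis_vec_def)
    then show ?thesis by (simp add: noise_density_def inner_axis prod_ennreal)
  qed
  have "emeasure (noise_law N0) (space (noise_law N0) :: (real^'n) set)
      = (\<integral>\<^sup>+z. ennreal (noise_density N0 (z :: real^'n)) \<partial>lborel)"
    by (simp add: noise_law_def emeasure_density)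
  also have "\<dots> = 1"
    unfolding prod by (subst nn_integral_lborel_prod) (auto simp: one)
  finally show "emeasure (noise_law N0) (space (noise_law N0) :: (real^'n) set) = 1" .
qed

text \<open>Translation invariance of Lebesgue measure moves the shift into the density. Outputs
  caused by different signals can then be compared under the single reference measure
  \<open>noise_law N0\<close>.\<close>

lemma noise_law_shift:
  assumes "0 < N0"
  shows "distr (noise_law N0) borel ((+) a) = density (noise_law N0) (tilt N0 a)"
proof -
  have "density lborel (\<lambda>y. ennreal (noise_density N0 (y - a)))
      = density (distr lborel borel ((+) a)) (\<lambda>y. ennreal (noise_density N0 (y - a)))"
    by (simp add: lborel_distr_plus)
  also have "\<dots> = distr (noise_law N0) borel ((+) a)"
    unfolding noise_law_def by (subst density_distr) auto
  finally show ?thesis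
    unfolding noise_law_def using assms
    by (subst density_density_eq)
       (auto simp: noise_density_shift ennreal_mult' less_imp_le noise_density_pos)
qed

lemma integral_shift_noise_law:
  fixes f :: "real^'n \<Rightarrow> real"
  assumes "0 < N0" and [measurable]: "f \<in> borel_measurable borel"
  shows "(\<integral>z. f (a + z) \<partial>noise_law N0) = (\<integral>y. tilt N0 a y * f y \<partial>noise_law N0)"
    and "integrable (noise_law N0) (\<lambda>z. f (a + z))
      \<longleftrightarrow> integrable (noise_law N0) (\<lambda>y. tilt N0 a y * f y)"
proof -
  have "(\<integral>z. f (a + z) \<partial>noise_law N0) = (\<integral>z. f z \<partial>distr (noise_law N0) borel ((+) a))"
    by (subst integral_distr) auto
  then show "(\<integral>z. f (a + z) \<partial>noise_law N0) = (\<integral>y. tilt N0 a y * f y \<partial>noise_law N0)"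
    unfolding noise_law_shift[OF assms(1)] by (subst (asm) integral_density) (auto simp: less_imp_le)
  have "integrable (noise_law N0) (\<lambda>z. f (a + z))
      \<longleftrightarrow> integrable (distr (noise_law N0) borel ((+) a)) f"
    by (subst integrable_distr_eq) auto
  then show "integrable (noise_law N0) (\<lambda>z. f (a + z))
      \<longleftrightarrow> integrable (noise_law N0) (\<lambda>y. tilt N0 a y * f y)"
    unfolding noise_law_shift[OF assms(1)]
    by (subst (asm) integrable_density) (auto simp: less_imp_le)
qed

text \<open>The constant function 1 in the change of measure: a shifted probability law still has
  mass one.\<close>

lemma tilt_integral:
  fixes a :: "real^'n"
  assumes "0 < N0"
  shows "integrable (noise_law N0) (tilt N0 a)" "(\<integral>y. tilt N0 a y \<partial>noise_law N0) = 1"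
proof -
  interpret prob_space "noise_law N0 :: (real^'n) measure" by (rule prob_space_noise_law[OF assms])
  show "integrable (noise_law N0) (tilt N0 a)" "(\<integral>y. tilt N0 a y \<partial>noise_law N0) = 1"
    using integral_shift_noise_law[OF assms, of "\<lambda>_. 1" a] by (auto simp: prob_space[simplified])
qed

lemma abs_exp_minus_le:
  assumes "\<bar>x\<bar> \<le> 1"
  shows "\<bar>exp x - 1 - x\<bar> \<le> (x::real)\<^sup>2"
proof (cases "0 \<le> x")
  case True
  then have "exp x \<le> 1 + x + x\<^sup>2" using exp_bound[of x] assms by simp
  then show ?thesis using exp_ge_add_one_self[of x] zero_le_power2[of x]
    unfolding abs_le_iff by linarith
next
  case False
  define u where "u = - x"
  have u: "0 < u" "u \<le> 1" using False assms by (auto simp: u_def)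
  have "exp u * exp (-u) = 1" by (simp add: exp_minus)
  moreover have "(1 + u) * exp (-u) \<le> exp u * exp (-u)"
    using exp_ge_add_one_self[of u] by (intro mult_right_mono) auto
  ultimately have "(1 + u) * exp (-u) \<le> 1" by simp
  \<comment> \<open>The right-hand side equals \<open>1 + u^3\<close>.\<close>
  also have "1 \<le> (1 + u) * (1 - u + u\<^sup>2)"
    using u by (simp add: algebra_simps power2_eq_square)
  finally have "exp (-u) \<le> 1 - u + u\<^sup>2" using u by (simp add: mult_le_cancel_left_pos)
  then have "exp x \<le> 1 + x + x\<^sup>2" by (simp add: u_def)
  then show ?thesis using exp_ge_add_one_self[of x] zero_le_power2[of x]
    unfolding abs_le_iff by linarith
qed

text \<open>By the binomial formula the moment is
  \<open>exp (12 * p) - 4 * exp (6 * p) + 6 * exp (2 * p) - 3\<close>, whose terms of order zero and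
  one in \<open>p\<close> cancel. The quadratic errors are \<open>144 + 6 * 4 = 168\<close>, and
  \<open>p \<le> 1/12\<close> keeps \<open>12 * p\<close> in the range of
  \<open>abs_exp_minus_le\<close>.\<close>

lemma tilt_fourth_moment:
  fixes a :: "real^'n"
  assumes "0 < N0" and q: "a \<bullet> a / N0 \<le> 1/12"
  shows "integrable (noise_law N0) (\<lambda>y. (tilt N0 a y - 1) ^ 4)"
    and "(\<integral>y. (tilt N0 a y - 1) ^ 4 \<partial>noise_law N0) \<le> 168 * (a \<bullet> a / N0)\<^sup>2"
proof -
  interpret prob_space "noise_law N0 :: (real^'n) measure" by (rule prob_space_noise_law[OF assms(1)])
  define p where "p = a \<bullet> a / N0"
  have p: "0 \<le> p" "p \<le> 1/12" using q assms(1) by (auto simp: p_def)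
  have pw: "tilt N0 a y ^ k = exp (real k * (real k - 1) * p) * tilt N0 (real k *\<^sub>R a) y" for k y
    unfolding p_def tilt_power by simp
  have eq: "(tilt N0 a y - 1) ^ 4 = exp (12 * p) * tilt N0 (4 *\<^sub>R a) y
     - 4 * exp (6 * p) * tilt N0 (3 *\<^sub>R a) y + 6 * exp (2 * p) * tilt N0 (2 *\<^sub>R a) y
     - 4 * tilt N0 a y + 1" for y
  proof -
    have "(t - 1) ^ 4 = t ^ 4 - 4 * t ^ 3 + 6 * t ^ 2 - 4 * t + 1" for t :: real
      by (simp add: eval_nat_numeral algebra_simps)
    then show ?thesis using pw[of y 4] pw[of y 3] pw[of y 2] by simp
  qed
  note int = tilt_integral(1)[OF assms(1)] and val = tilt_integral(2)[OF assms(1)]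
  show "integrable (noise_law N0) (\<lambda>y. (tilt N0 a y - 1) ^ 4)"
    unfolding eq by (intro Bochner_Integration.integrable_add Bochner_Integration.integrable_diff
        integrable_mult_right int) simp
  have "(\<integral>y. (tilt N0 a y - 1) ^ 4 \<partial>noise_law N0)
      = exp (12 * p) - 4 * exp (6 * p) + 6 * exp (2 * p) - 3"
    unfolding eq by (simp add: int val prob_space[simplified])
  moreover have "\<bar>exp (12 * p) - 1 - 12 * p\<bar> \<le> 144 * p\<^sup>2"
      "\<bar>exp (2 * p) - 1 - 2 * p\<bar> \<le> 4 * p\<^sup>2"
    using p abs_exp_minus_le[of "12 * p"] abs_exp_minus_le[of "2 * p"] by simp_all
  moreover have "1 + 6 * p \<le> exp (6 * p)" by (rule exp_ge_add_one_self)
  ultimately show "(\<integral>y. (tilt N0 a y - 1) ^ 4 \<partial>noise_law N0) \<le> 168 * (a \<bullet> a / N0)\<^sup>2"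
    unfolding p_def[symmetric] abs_le_iff by linarith
qed

section \<open>Elementary bounds on the logarithm and the binary entropy\<close>

text \<open>The logarithm minus its quadratic Taylor polynomial has derivative
  \<open>x^2 / (1 + x)\<close>, so it increases through 0 and the bound changes direction there.
  With the cubic term the remainder has derivative \<open>x^3 / (1 + x)\<close>, which has the sign
  of \<open>x\<close>; its minimum is at 0, so the third bound holds on both sides.\<close>

lemma ln_taylor_bounds:
  assumes "-1 < t"
  shows "0 \<le> t \<Longrightarrow> t - t\<^sup>2 / 2 \<le> ln (1 + t)" "t \<le> 0 \<Longrightarrow> ln (1 + t) \<le> t - t\<^sup>2 / 2"
    "ln (1 + t) \<le> t - t\<^sup>2 / 2 + (t::real) ^ 3 / 3"
proof -
  show "t - t\<^sup>2 / 2 \<le> ln (1 + t)" if "0 \<le> t"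
  proof -
    have "(\<lambda>x. ln (1 + x) - x + x\<^sup>2 / 2) 0 \<le> (\<lambda>x. ln (1 + x) - x + x\<^sup>2 / 2) t"
      by (rule DERIV_nonneg_imp_nondecreasing[OF that])
         (auto intro!: derivative_eq_intros exI simp: field_simps)
    then show ?thesis by simp
  qed
  show "ln (1 + t) \<le> t - t\<^sup>2 / 2" if "t \<le> 0"
  proof -
    have "(\<lambda>x. ln (1 + x) - x + x\<^sup>2 / 2) t \<le> (\<lambda>x. ln (1 + x) - x + x\<^sup>2 / 2) 0"
      using assms by (intro DERIV_nonneg_imp_nondecreasing[OF that])
         (auto intro!: derivative_eq_intros exI simp: field_simps)
    then show ?thesis by simp
  qed
  let ?g = "\<lambda>x::real. x - x\<^sup>2 / 2 + x ^ 3 / 3 - ln (1 + x)"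
  have d: "(?g has_real_derivative x ^ 3 / (1 + x)) (at x)" if "-1 < x" for x
    using that by (auto intro!: derivative_eq_intros simp: field_simps eval_nat_numeral)
  show "ln (1 + t) \<le> t - t\<^sup>2 / 2 + t ^ 3 / 3"
  proof (cases "0 \<le> t")
    case True
    have "?g 0 \<le> ?g t"
      by (rule DERIV_nonneg_imp_nondecreasing[OF True]) (use d in \<open>force intro!: exI\<close>)
    then show ?thesis by simp
  next
    case False
    have "?g 0 \<le> ?g t"
    proof (rule DERIV_nonpos_imp_nonincreasing[of t 0 ?g])
      show "t \<le> 0" using False by simp
      fix x assume "t \<le> x" "x \<le> 0"
      then have "-1 < x" "x ^ 3 / (1 + x) \<le> 0"
        using assms by (auto simp: divide_le_0_iff power_le_zero_eq)
      then show "\<exists>y. (?g has_real_derivative y) (at x) \<and> y \<le> 0" using d by blast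
    qed
    then show ?thesis by simp
  qed
qed

text \<open>\<open>f\<close> is the relative entropy, in nats, of a bit with probabilities
  \<open>(1 + t) / 2\<close> and \<open>(1 - t) / 2\<close> from a fair bit. In the lower bound the
  derivative is nonnegative because the quadratic parts of the two logarithm bounds cancel; in the
  upper bound the odd powers of \<open>t\<close> cancel.\<close>

lemma symmetrised_entropy_bounds:
  fixes t :: real
  assumes "\<bar>t\<bar> < 1"
  defines "f \<equiv> ((1 + t) * ln (1 + t) + (1 - t) * ln (1 - t)) / 2"
  shows "t\<^sup>2 / 2 \<le> f" "f \<le> t\<^sup>2 / 2 + t ^ 4 / 3"
proof -
  let ?g = "\<lambda>x::real. (1 + x) * ln (1 + x) + (1 - x) * ln (1 - x) - x\<^sup>2"
  have *: "?g 0 \<le> ?g u" if u: "0 \<le> u" "u < 1" for u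
  proof (rule DERIV_nonneg_imp_nondecreasing[OF u(1)])
    fix x assume x: "0 \<le> x" "x \<le> u"
    have "0 \<le> ln (1 + x) - ln (1 - x) - 2 * x"
      using ln_taylor_bounds(1)[of x] ln_taylor_bounds(2)[of "-x"] x u by simp
    moreover have "(?g has_real_derivative ln (1 + x) - ln (1 - x) - 2 * x) (at x)"
      using x u by (auto intro!: derivative_eq_intros)
    ultimately show "\<exists>y. (?g has_real_derivative y) (at x) \<and> 0 \<le> y" by blast
  qed
  \<comment> \<open>\<open>?g\<close> is even, so nonnegative arguments suffice.\<close>
  have "?g 0 \<le> ?g \<bar>t\<bar>" by (rule *) (use assms in auto)
  then show "t\<^sup>2 / 2 \<le> f" unfolding f_def by (cases "0 \<le> t") auto
  have "(1 + t) * ln (1 + t) \<le> (1 + t) * (t - t\<^sup>2 / 2 + t ^ 3 / 3)"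
    "(1 - t) * ln (1 - t) \<le> (1 - t) * (- t - t\<^sup>2 / 2 - t ^ 3 / 3)"
    using ln_taylor_bounds(3)[of t] ln_taylor_bounds(3)[of "-t"] assms(1)
    by (auto intro!: mult_left_mono simp: power3_eq_cube)
  then show "f \<le> t\<^sup>2 / 2 + t ^ 4 / 3"
    unfolding f_def by (simp add: field_simps eval_nat_numeral)
qed

section \<open>Averages over a finite index set\<close>

text \<open>The uniform expectation as a plain sum: nested averages over pairs and triples of
  codewords can then be rewritten by linearity alone.\<close>

definition avg :: "'i set \<Rightarrow> ('i \<Rightarrow> real) \<Rightarrow> real" where
  "avg A f = (\<Sum>i\<in>A. f i) / real (card A)"

lemma avg_add: "avg A (\<lambda>i. f i + g i) = avg A f + avg A g"
  by (simp add: avg_def sum.distrib add_divide_distrib)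

lemma avg_diff: "avg A (\<lambda>i. f i - g i) = avg A f - avg A g"
  by (simp add: avg_def sum_subtractf diff_divide_distrib)

lemma avg_cmult: "avg A (\<lambda>i. c * f i) = c * avg A f"
  by (simp add: avg_def sum_distrib_left)

lemma avg_multc: "avg A (\<lambda>i. f i * c) = avg A f * c"
  by (simp add: avg_def sum_distrib_right)

lemma avg_const: "finite A \<Longrightarrow> A \<noteq> {} \<Longrightarrow> avg A (\<lambda>_. c) = c"
  by (simp add: avg_def)

lemma avg_mono: "(\<And>i. i \<in> A \<Longrightarrow> f i \<le> g i) \<Longrightarrow> avg A f \<le> avg A g"
  by (simp add: avg_def sum_mono divide_right_mono)

lemma avg_cong: "(\<And>i. i \<in> A \<Longrightarrow> f i = g i) \<Longrightarrow> avg A f = avg A g"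
  by (simp add: avg_def)

lemma avg_le:
  assumes "finite A" "A \<noteq> {}" "\<And>i. i \<in> A \<Longrightarrow> f i \<le> c"
  shows "avg A f \<le> c"
  using avg_mono[of A f "\<lambda>_. c"] avg_const[OF assms(1,2), of c] assms(3) by simp

lemma avg_ge:
  assumes "finite A" "A \<noteq> {}" "\<And>i. i \<in> A \<Longrightarrow> c \<le> f i"
  shows "c \<le> avg A f"
  using avg_mono[of A "\<lambda>_. c" f] avg_const[OF assms(1,2), of c] assms(3) by simp

lemma abs_avg_le: "\<bar>avg A f\<bar> \<le> avg A (\<lambda>i. \<bar>f i\<bar>)"
  by (simp add: avg_def abs_divide divide_right_mono)

lemma avg_product: "avg A f * avg B g = avg A (\<lambda>i. avg B (\<lambda>j. f i * g j))"
  by (simp add: avg_cmult avg_multc)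

lemma integral_avg:
  assumes "\<And>i. i \<in> A \<Longrightarrow> integrable M (f i)"
  shows "(\<integral>x. avg A (\<lambda>i. f i x) \<partial>M) = avg A (\<lambda>i. \<integral>x. f i x \<partial>M)"
    and "integrable M (\<lambda>x. avg A (\<lambda>i. f i x))"
  using assms by (simp_all add: avg_def)

lemma has_bochner_integral_avg:
  assumes "\<And>i. i \<in> A \<Longrightarrow> has_bochner_integral M (f i) (x i)"
  shows "has_bochner_integral M (\<lambda>y. avg A (\<lambda>i. f i y)) (avg A x)"
  unfolding avg_def using assms by (intro has_bochner_integral_divide_zero has_bochner_integral_sum)

text \<open>Jensen's inequality for the square, that is nonnegativity of the variance, applied
  twice.\<close>

lemma avg_power4_le:
  assumes "finite A" "A \<noteq> {}"
  shows "avg A f ^ 4 \<le> avg A (\<lambda>i. f i ^ 4)"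
proof -
  have sq: "(avg A g)\<^sup>2 \<le> avg A (\<lambda>i. (g i)\<^sup>2)" for g
  proof -
    have "0 \<le> avg A (\<lambda>i. (g i - avg A g)\<^sup>2)" by (rule avg_ge[OF assms]) simp
    also have "\<dots> = avg A (\<lambda>i. (g i)\<^sup>2) - 2 * avg A g * avg A g + (avg A g)\<^sup>2"
      by (simp add: power2_diff avg_add avg_diff avg_cmult avg_multc avg_const[OF assms] mult.assoc
          cong: avg_cong)
    finally show ?thesis by (simp add: power2_eq_square)
  qed
  have "avg A f ^ 4 = ((avg A f)\<^sup>2)\<^sup>2" by simp
  also have "\<dots> \<le> (avg A (\<lambda>i. (f i)\<^sup>2))\<^sup>2" by (intro power_mono sq) simp
  also have "\<dots> \<le> avg A (\<lambda>i. ((f i)\<^sup>2)\<^sup>2)" by (rule sq)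
  finally show ?thesis by simp
qed

section \<open>Information of one bit at fixed fading\<close>

text \<open>
  The index set is the set of codewords, \<open>s\<close> the value of the bit under consideration and \<open>a\<close> the
  faded symbol. Given the bit \<open>\<plusminus>1\<close>, the output has density \<open>G \<plusminus> D\<close> relative to the noise.
\<close>

locale balanced_signals =
  fixes A :: "'i set" and s :: "'i \<Rightarrow> real" and a :: "'i \<Rightarrow> real^'n" and N0 :: real
  assumes fin: "finite A" "A \<noteq> {}"
    and sign: "i \<in> A \<Longrightarrow> s i = 1 \<or> s i = -1"
    and sum_sign: "(\<Sum>i\<in>A. s i) = 0"
    and sum_signal: "(\<Sum>i\<in>A. a i) = 0"
    and N0: "0 < N0"
begin

definition G where "G y = avg A (\<lambda>i. tilt N0 (a i) y)"
definition D where "D y = avg A (\<lambda>i. s i * tilt N0 (a i) y)"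
definition v where "v = (1 / real (card A)) *\<^sub>R (\<Sum>i\<in>A. s i *\<^sub>R a i)"
text \<open>Mutual information, in nats, between the bit and the output: the log-likelihood ratio is
  that of \<open>G + s i * D\<close> to \<open>G\<close>.\<close>

definition info where
  "info = avg A (\<lambda>i. \<integral>z. ln (1 + s i * (D (a i + z) / G (a i + z))) \<partial>noise_law N0)"

sublocale P: prob_space "noise_law N0 :: (real^'n) measure"
  by (rule prob_space_noise_law[OF N0])

lemma meas [measurable]: "G \<in> borel_measurable borel" "D \<in> borel_measurable borel"
  unfolding G_def D_def avg_def by measurable

lemma G_pos: "0 < G y"
  unfolding G_def avg_def using fin by (auto intro!: divide_pos_pos sum_pos simp: card_gt_0_iff)

lemma sign_abs: "i \<in> A \<Longrightarrow> \<bar>s i\<bar> = 1"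
  using sign by fastforce

lemma exists_sign: "\<exists>i\<in>A. s i = 1" "\<exists>i\<in>A. s i = -1"
proof -
  have "(\<Sum>i\<in>A. s i) \<noteq> 0" if "\<not> (\<exists>i\<in>A. s i = 1)"
  proof -
    have "(\<Sum>i\<in>A. s i) = (\<Sum>i\<in>A. - 1)" using that sign by (intro sum.cong) auto
    then show ?thesis using fin by (simp add: card_gt_0_iff)
  qed
  then show "\<exists>i\<in>A. s i = 1" using sum_sign by blast
  have "(\<Sum>i\<in>A. s i) \<noteq> 0" if "\<not> (\<exists>i\<in>A. s i = -1)"
  proof -
    have "(\<Sum>i\<in>A. s i) = (\<Sum>i\<in>A. 1)" using that sign by (intro sum.cong) auto
    then show ?thesis using fin by (simp add: card_gt_0_iff)
  qed
  then show "\<exists>i\<in>A. s i = -1" using sum_sign by blast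
qed

text \<open>In \<open>G \<plusminus> D\<close> each tilt has weight 0 or 2, and weight 2 does occur
  because both signs are taken. Strictness keeps the arguments of all logarithms positive.\<close>

lemma abs_D_less_G: "\<bar>D y\<bar> < G y"
proof -
  have "0 < G y + e * D y" if "e = 1 \<or> e = -1" for e
  proof -
    have "G y + e * D y = avg A (\<lambda>i. (1 + e * s i) * tilt N0 (a i) y)"
      by (simp add: G_def D_def distrib_right avg_add avg_cmult mult.assoc)
    also have "\<dots> > 0"
    proof -
      have "\<exists>i\<in>A. s i = e" using exists_sign that by auto
      then obtain i where i: "i \<in> A" "s i = e" by blast
      have "0 < (\<Sum>j\<in>A. (1 + e * s j) * tilt N0 (a j) y)"
      proof (rule sum_pos2[of A i])
        show "0 \<le> (1 + e * s j) * tilt N0 (a j) y" if "j \<in> A" for j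
          using sign[OF that] \<open>e = 1 \<or> e = -1\<close> by (auto simp: less_imp_le)
      qed (use fin i that in auto)
      then show ?thesis using fin by (simp add: avg_def card_gt_0_iff)
    qed
    finally show ?thesis .
  qed
  from this[of 1] this[of "-1"] show ?thesis by (simp add: abs_less_iff)
qed

lemma abs_ratio: "\<bar>D y / G y\<bar> < 1"
  using abs_D_less_G[of y] G_pos[of y] by (simp add: abs_divide)

lemma integrable_G: "integrable (noise_law N0) G" and integral_G: "(\<integral>y. G y \<partial>noise_law N0) = 1"
  unfolding G_def using N0 by (simp_all add: integral_avg tilt_integral avg_const fin)

end

context balanced_signals begin

text \<open>
  Domination by \<open>G\<close>, which uses \<open>tilt N0 (a i) \<le> card A * (G + s i * D)\<close> and the boundedness of
  \<open>u * \<bar>ln u\<bar>\<close> on \<open>(0, 2)\<close>, makes the bound independent of the signals.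
\<close>

lemma entropy_term_integrable:
  assumes i: "i \<in> A"
  shows "integrable (noise_law N0) (\<lambda>y. tilt N0 (a i) y * ln (1 + s i * (D y / G y)))"
    and "integrable (noise_law N0) (\<lambda>y. tilt N0 (a i) y * \<bar>ln (1 + s i * (D y / G y))\<bar>)"
    and "(\<integral>y. tilt N0 (a i) y * \<bar>ln (1 + s i * (D y / G y))\<bar> \<partial>noise_law N0) \<le> 2 * real (card A)"
proof -
  let ?n = "real (card A)"
  have bound: "tilt N0 (a i) y * \<bar>ln (1 + s i * (D y / G y))\<bar> \<le> 2 * ?n * G y" for y
  proof -
    define u where "u = 1 + s i * (D y / G y)"
    have "-1 < D y / G y" "D y / G y < 1" using abs_ratio[of y] unfolding abs_less_iff by linarith+
    then have u: "0 < u" "u < 2" using sign[OF i] by (auto simp: u_def)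
    have n: "0 < ?n" using fin by (simp add: card_gt_0_iff)
    have "?n * (G y + s i * D y) = (\<Sum>j\<in>A. (1 + s i * s j) * tilt N0 (a j) y)"
      using n by (simp add: G_def D_def avg_def field_simps sum.distrib sum_distrib_left)
    moreover have "(1 + s i * s i) * tilt N0 (a i) y \<le> (\<Sum>j\<in>A. (1 + s i * s j) * tilt N0 (a j) y)"
    proof (rule member_le_sum[OF i])
      show "0 \<le> (1 + s i * s j) * tilt N0 (a j) y" if "j \<in> A - {i}" for j
        using sign[of j] sign[OF i] that by (auto simp: less_imp_le)
    qed (use fin in auto)
    moreover have "(1 + s i * s i) * tilt N0 (a i) y = 2 * tilt N0 (a i) y"
      using sign[OF i] by auto
    ultimately have "tilt N0 (a i) y \<le> ?n * (G y + s i * D y)"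
      using tilt_pos[of N0 "a i" y] by linarith
    also have "\<dots> = ?n * G y * u" using G_pos[of y] by (simp add: u_def field_simps)
    finally have "tilt N0 (a i) y * \<bar>ln u\<bar> \<le> ?n * G y * u * \<bar>ln u\<bar>" by (intro mult_right_mono) auto
    also have "\<dots> = ?n * G y * (u * \<bar>ln u\<bar>)" by simp
    also have "\<dots> \<le> ?n * G y * 2"
    proof (rule mult_left_mono)
      show "u * \<bar>ln u\<bar> \<le> 2"
      proof (cases "1 \<le> u")
        case True
        then have "u * \<bar>ln u\<bar> = u * ln u" by simp
        also have "\<dots> \<le> 2 * 1" using u True ln_le_minus_one[of u] by (intro mult_mono) auto
        finally show ?thesis by simp
      next
        case False
        then have "u * \<bar>ln u\<bar> = u * ln (1 / u)" using u by (simp add: ln_div)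
        also have "\<dots> \<le> u * (1 / u - 1)" using u ln_le_minus_one[of "1 / u"] by (intro mult_left_mono) auto
        also have "\<dots> \<le> 2" using u by (simp add: field_simps)
        finally show ?thesis .
      qed
    qed (use n G_pos[of y] in auto)
    finally show ?thesis by (simp add: u_def mult.commute mult.left_commute)
  qed
  have intG: "integrable (noise_law N0) (\<lambda>y. 2 * ?n * G y)"
    by (intro integrable_mult_right integrable_G)
  show 1: "integrable (noise_law N0) (\<lambda>y. tilt N0 (a i) y * \<bar>ln (1 + s i * (D y / G y))\<bar>)"
  proof (rule Bochner_Integration.integrable_bound[OF intG])
    show "AE y in noise_law N0. norm (tilt N0 (a i) y * \<bar>ln (1 + s i * (D y / G y))\<bar>)
      \<le> norm (2 * ?n * G y)"
      using bound G_pos by (intro AE_I2) (auto simp: abs_mult less_imp_le)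
  qed measurable
  show "integrable (noise_law N0) (\<lambda>y. tilt N0 (a i) y * ln (1 + s i * (D y / G y)))"
  proof (rule Bochner_Integration.integrable_bound[OF intG])
    show "AE y in noise_law N0. norm (tilt N0 (a i) y * ln (1 + s i * (D y / G y)))
      \<le> norm (2 * ?n * G y)"
      using bound G_pos by (intro AE_I2) (auto simp: abs_mult less_imp_le)
  qed measurable
  have "(\<integral>y. tilt N0 (a i) y * \<bar>ln (1 + s i * (D y / G y))\<bar> \<partial>noise_law N0)
      \<le> (\<integral>y. 2 * ?n * G y \<partial>noise_law N0)"
    by (rule integral_mono[OF 1 intG bound])
  then show "(\<integral>y. tilt N0 (a i) y * \<bar>ln (1 + s i * (D y / G y))\<bar> \<partial>noise_law N0) \<le> 2 * ?n"
    by (simp add: integral_G)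
qed

text \<open>The change of measure read backwards: the tilt by \<open>a i\<close> becomes the
  translation by \<open>a i\<close>, which is the form in which the capacity integral contains this
  term.\<close>

lemma information_density_integrable:
  assumes i: "i \<in> A"
  shows "integrable (noise_law N0) (\<lambda>z. ln (1 + s i * (D (a i + z) / G (a i + z))))"
    and "(\<integral>z. \<bar>ln (1 + s i * (D (a i + z) / G (a i + z)))\<bar> \<partial>noise_law N0) \<le> 2 * real (card A)"
  using entropy_term_integrable[OF i]
    integral_shift_noise_law(2)[OF N0, of "\<lambda>y. ln (1 + s i * (D y / G y))" "a i"]
    integral_shift_noise_law(1)[OF N0, of "\<lambda>y. \<bar>ln (1 + s i * (D y / G y))\<bar>" "a i"]
  by simp_all

text \<open>Given the output \<open>y\<close>, the bit has posterior probabilities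
  \<open>(1 \<plusminus> D y / G y) / 2\<close>; \<open>F (D y / G y)\<close> is the relative
  entropy of this posterior from the fair prior.\<close>

definition F where "F t = ((1 + t) * ln (1 + t) + (1 - t) * ln (1 - t)) / (2::real)"

text \<open>Averaging over the codewords before integrating turns the information into the mean
  relative entropy of posterior from prior, the output having density \<open>G\<close> relative to
  the noise.\<close>

lemma info_eq: "info = (\<integral>y. G y * F (D y / G y) \<partial>noise_law N0)"
  and integrable_F: "integrable (noise_law N0) (\<lambda>y. G y * F (D y / G y))"
proof -
  have eq: "avg A (\<lambda>i. tilt N0 (a i) y * ln (1 + s i * (D y / G y))) = G y * F (D y / G y)" for y
  proof -
    define t where "t = D y / G y"
    have GD: "G y * t = D y" using G_pos[of y] by (simp add: t_def)
    \<comment> \<open>For a sign \<open>s i\<close>, the logarithm of \<open>1 + s i * t\<close> is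
      its even part in \<open>t\<close> plus \<open>s i\<close> times its odd part. The two parts
      then pick up the averages \<open>G\<close> and \<open>D\<close>.\<close>
    have "avg A (\<lambda>i. tilt N0 (a i) y * ln (1 + s i * t)) = avg A (\<lambda>i. 
        tilt N0 (a i) y * ((ln (1 + t) + ln (1 - t)) / 2)
        + s i * tilt N0 (a i) y * ((ln (1 + t) - ln (1 - t)) / 2))"
    proof (rule avg_cong)
      fix i assume "i \<in> A"
      show "tilt N0 (a i) y * ln (1 + s i * t) = tilt N0 (a i) y * ((ln (1 + t) + ln (1 - t)) / 2)
        + s i * tilt N0 (a i) y * ((ln (1 + t) - ln (1 - t)) / 2)"
        using sign[OF \<open>i \<in> A\<close>] by (elim disjE) (simp_all add: field_simps)
    qed
    also have "\<dots> = G y * ((ln (1 + t) + ln (1 - t)) / 2) + D y * ((ln (1 + t) - ln (1 - t)) / 2)"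
      by (simp only: avg_add avg_multc G_def D_def)
    also have "\<dots> = G y * F t"
      unfolding GD[symmetric] F_def by (simp add: field_simps)
    finally show ?thesis by (simp add: t_def)
  qed
  have "info = avg A (\<lambda>i. \<integral>y. tilt N0 (a i) y * ln (1 + s i * (D y / G y)) \<partial>noise_law N0)"
    unfolding info_def by (intro avg_cong integral_shift_noise_law[OF N0]) measurable
  also have "\<dots> = (\<integral>y. avg A (\<lambda>i. tilt N0 (a i) y * ln (1 + s i * (D y / G y))) \<partial>noise_law N0)"
    by (rule integral_avg(1)[symmetric]) (rule entropy_term_integrable)
  finally show "info = (\<integral>y. G y * F (D y / G y) \<partial>noise_law N0)" by (simp only: eq)
  show "integrable (noise_law N0) (\<lambda>y. G y * F (D y / G y))"
    unfolding eq[symmetric] by (rule integral_avg(2)) (rule entropy_term_integrable)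
qed

text \<open>For \<open>\<bar>t\<bar> < 1\<close> the quartic bound gives at most
  \<open>1/2 + 1/3\<close>. This crude estimate serves for fadings at which the signal is not
  weak.\<close>

lemma info_bounds: "0 \<le> info" "info \<le> 1"
proof -
  have F: "0 \<le> F t" "F t \<le> 1" if "\<bar>t\<bar> < 1" for t
  proof -
    have "t\<^sup>2 \<le> 1" using that by (simp add: abs_square_le_1)
    moreover have "t ^ 4 = (t\<^sup>2)\<^sup>2" by simp
    moreover have "(t\<^sup>2)\<^sup>2 \<le> 1" using \<open>t\<^sup>2 \<le> 1\<close> by (rule power_le_one[rotated]) simp
    ultimately show "0 \<le> F t" "F t \<le> 1"
      using symmetrised_entropy_bounds[OF that] zero_le_power2[of t]
      unfolding F_def by linarith+
  qed
  show "0 \<le> info"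
    unfolding info_eq using F(1)[OF abs_ratio] G_pos by (intro Bochner_Integration.integral_nonneg) (auto simp: less_imp_le)
  have "info \<le> (\<integral>y. G y * 1 \<partial>noise_law N0)"
    unfolding info_eq using F(2)[OF abs_ratio] G_pos
    by (intro integral_mono integrable_F mult_left_mono) (auto simp: integrable_G less_imp_le)
  then show "info \<le> 1" by (simp add: integral_G)
qed

section \<open>Moments of \<open>D\<close> and \<open>G\<close> under the noise law\<close>

lemma avg_sign: "avg A s = 0"
  by (simp add: avg_def sum_sign)

lemma avg_inner: "avg A (\<lambda>i. b \<bullet> a i) = 0" "avg A (\<lambda>i. a i \<bullet> b) = 0"
  by (simp_all add: avg_def inner_sum_right[symmetric] inner_sum_left[symmetric] sum_signal)

lemma v_inner: "v \<bullet> v = avg A (\<lambda>i. avg A (\<lambda>j. s i * s j * (a i \<bullet> a j)))"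
  by (simp add: v_def avg_def inner_sum_left inner_sum_right sum_distrib_left sum_divide_distrib
      mult_ac inner_commute)

lemma has_integral_tilt: "has_bochner_integral (noise_law N0) (\<lambda>y. c * tilt N0 b y) c" for b :: "real^'n"
  using has_bochner_integral_mult_right[of c "noise_law N0" "tilt N0 b" 1] tilt_integral[OF N0, of b]
  by (auto simp: has_bochner_integral_iff)

text \<open>The square is a double average of products of tilts; each product collapses by
  \<open>tilt_mult\<close>, and every tilt integrates to one.\<close>

lemma D_squared_integral: "has_bochner_integral (noise_law N0) (\<lambda>y. (D y)\<^sup>2)
    (avg A (\<lambda>i. avg A (\<lambda>j. s i * s j * exp (2 * (a i \<bullet> a j) / N0))))"
proof -
  have "(D y)\<^sup>2 = avg A (\<lambda>i. avg A (\<lambda>j.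
      s i * s j * exp (2 * (a i \<bullet> a j) / N0) * tilt N0 (a i + a j) y))" for y
    unfolding D_def power2_eq_square avg_product
    by (intro avg_cong, simp only: mult.assoc tilt_mult[symmetric], simp only: mult_ac)
  then show ?thesis by (simp only:) (intro has_bochner_integral_avg has_integral_tilt)
qed

lemma G_D_squared_integral: "has_bochner_integral (noise_law N0) (\<lambda>y. G y * (D y)\<^sup>2)
    (avg A (\<lambda>k. avg A (\<lambda>i. avg A (\<lambda>j.
      s i * s j * exp (2 * (a i \<bullet> a j) / N0 + 2 * (a i \<bullet> a k + a j \<bullet> a k) / N0)))))"
proof -
  have *: "exp (2 * (a i \<bullet> a j) / N0 + 2 * (a i \<bullet> a k + a j \<bullet> a k) / N0) * tilt N0 (a i + a j + a k) y
    = tilt N0 (a i) y * tilt N0 (a j) y * tilt N0 (a k) y" for i j k y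
    by (simp add: tilt_mult exp_add inner_add_left mult.assoc)
  have "G y * (D y)\<^sup>2 = avg A (\<lambda>k. avg A (\<lambda>i. avg A (\<lambda>j. s i * s j
      * exp (2 * (a i \<bullet> a j) / N0 + 2 * (a i \<bullet> a k + a j \<bullet> a k) / N0)
      * tilt N0 (a i + a j + a k) y)))" for y
    unfolding D_def G_def power2_eq_square avg_product
    unfolding avg_cmult[symmetric]
    by (intro avg_cong, subst mult.assoc, subst *, simp only: mult_ac)
  then show ?thesis by (simp only:) (intro has_bochner_integral_avg has_integral_tilt)
qed

lemma abs_sign_mult_le:
  assumes "i \<in> A" "j \<in> A"
  shows "\<bar>s i * s j * x\<bar> \<le> \<bar>x\<bar>"
  using sign_abs assms by (simp add: abs_mult)

lemma abs_inner_le: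
  assumes "\<And>i. i \<in> A \<Longrightarrow> a i \<bullet> a i \<le> r" "i \<in> A" "j \<in> A"
  shows "\<bar>a i \<bullet> a j\<bar> \<le> r"
proof -
  have "0 \<le> (a i - a j) \<bullet> (a i - a j)" "0 \<le> (a i + a j) \<bullet> (a i + a j)" by simp_all
  then show ?thesis using assms(1)[OF assms(2)] assms(1)[OF assms(3)]
    by (simp add: inner_add_left inner_add_right inner_diff_left inner_diff_right inner_commute)
qed

lemma v_inner_le:
  assumes "\<And>i. i \<in> A \<Longrightarrow> a i \<bullet> a i \<le> r"
  shows "v \<bullet> v \<le> r"
  unfolding v_inner
proof (intro avg_le fin)
  fix i j assume "i \<in> A" "j \<in> A"
  then show "s i * s j * (a i \<bullet> a j) \<le> r"
    using abs_sign_mult_le[of i j "a i \<bullet> a j"] abs_inner_le[OF assms, of i j] by linarith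
qed

text \<open>\<open>q\<close> bounds the signal energies divided by \<open>N0\<close>. The threshold
  is the one of \<open>tilt_fourth_moment\<close>; it also keeps the exponents below, at most
  \<open>6 * q\<close>, in the range of \<open>abs_exp_minus_le\<close>.\<close>

context
  fixes q :: real
  assumes signal: "\<And>i. i \<in> A \<Longrightarrow> a i \<bullet> a i \<le> q * N0" and q: "q \<le> 1/12"
begin

lemma q_nonneg: "0 \<le> q"
proof -
  obtain i where "i \<in> A" using fin by blast
  have "0 \<le> a i \<bullet> a i" by simp
  also have "\<dots> \<le> q * N0" using signal \<open>i \<in> A\<close> by blast
  finally show ?thesis using N0 by (simp add: zero_le_mult_iff)
qed

lemma correlation_le:
  assumes "i \<in> A" "j \<in> A"
  shows "\<bar>2 * (a i \<bullet> a j) / N0\<bar> \<le> 2 * q"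
  using abs_inner_le[OF signal assms] N0 by (simp add: abs_mult field_simps)

text \<open>When the exponentials are expanded, the constant terms vanish because the signs average
  to zero, and the linear terms reassemble to the squared norm of \<open>v\<close>. The remainder is
  at most \<open>(2 * q)^2\<close>.\<close>

lemma D_squared_bound: "\<bar>(\<integral>y. (D y)\<^sup>2 \<partial>noise_law N0) - 2 * (v \<bullet> v) / N0\<bar> \<le> 4 * q\<^sup>2"
proof -
  let ?x = "\<lambda>i j. 2 * (a i \<bullet> a j) / N0"
  have one: "avg A (\<lambda>i. avg A (\<lambda>j. s i * s j)) = 0"
    by (simp add: avg_cmult avg_multc avg_sign avg_const[OF fin])
  have lin: "avg A (\<lambda>i. avg A (\<lambda>j. s i * s j * ?x i j)) = 2 * (v \<bullet> v) / N0"
  proof -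
    have "avg A (\<lambda>i. avg A (\<lambda>j. s i * s j * ?x i j)) 
      = avg A (\<lambda>i. avg A (\<lambda>j. 2 / N0 * (s i * s j * (a i \<bullet> a j))))"
      by (intro avg_cong) simp
    then show ?thesis by (simp only: avg_cmult v_inner) simp
  qed
  have "(\<integral>y. (D y)\<^sup>2 \<partial>noise_law N0) - 2 * (v \<bullet> v) / N0
      = avg A (\<lambda>i. avg A (\<lambda>j. s i * s j * (exp (?x i j) - 1 - ?x i j)))"
    unfolding has_bochner_integral_integral_eq[OF D_squared_integral] right_diff_distrib avg_diff lin
    using one by simp
  also have "\<bar>\<dots>\<bar> \<le> 4 * q\<^sup>2"
  proof (rule order_trans[OF abs_avg_le], intro avg_le fin, rule order_trans[OF abs_avg_le], intro avg_le fin)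
    fix i j assume ij: "i \<in> A" "j \<in> A"
    have x: "\<bar>?x i j\<bar> \<le> 2 * q" by (rule correlation_le[OF ij])
    have "\<bar>exp (?x i j) - 1 - ?x i j\<bar> \<le> (?x i j)\<^sup>2"
      using x q by (intro abs_exp_minus_le) linarith
    also have "\<dots> \<le> (2 * q)\<^sup>2" using x q_nonneg by (simp only: abs_le_square_iff[symmetric])
    finally show "\<bar>s i * s j * (exp (?x i j) - 1 - ?x i j)\<bar> \<le> 4 * q\<^sup>2"
      using abs_sign_mult_le[OF ij, of "exp (?x i j) - 1 - ?x i j"]
      unfolding power_mult_distrib by simp
  qed
  finally show ?thesis .
qed

text \<open>The factor \<open>G\<close> adds \<open>?y\<close> to the exponent. Each summand of
  \<open>?y\<close> involves only one of the signed indices \<open>i\<close> and \<open>j\<close>,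
  so averaging over the other sign kills it. What remains is of second order, with constant
  \<open>2^2 + 6^2 = 40\<close>.\<close>

lemma mixed_moment_bound:
  "\<bar>(\<integral>y. (D y)\<^sup>2 \<partial>noise_law N0) - (\<integral>y. G y * (D y)\<^sup>2 \<partial>noise_law N0)\<bar> \<le> 40 * q\<^sup>2"
proof -
  let ?x = "\<lambda>i j. 2 * (a i \<bullet> a j) / N0" and ?y = "\<lambda>i j k. 2 * (a i \<bullet> a k + a j \<bullet> a k) / N0"
  have lin: "avg A (\<lambda>k. avg A (\<lambda>i. avg A (\<lambda>j. s i * s j * ?y i j k))) = 0"
  proof -
    have "avg A (\<lambda>k. avg A (\<lambda>i. avg A (\<lambda>j. s i * s j * ?y i j k)))
      = avg A (\<lambda>k. avg A (\<lambda>i. avg A (\<lambda>j.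
          (2 / N0 * (s i * (a i \<bullet> a k))) * s j + s i * (2 / N0 * (s j * (a j \<bullet> a k))))))"
      by (intro avg_cong) (simp add: algebra_simps add_divide_distrib)
    then show ?thesis
      by (simp only: avg_add avg_cmult avg_multc avg_sign mult_zero_right mult_zero_left
          avg_const[OF fin] add_0)
  qed
  \<comment> \<open>The vanishing linear term is added so that the two exponentials cancel to first
    order for each triple of indices.\<close>
  have "(\<integral>y. (D y)\<^sup>2 \<partial>noise_law N0) - (\<integral>y. G y * (D y)\<^sup>2 \<partial>noise_law N0)
      = avg A (\<lambda>k. avg A (\<lambda>i. avg A (\<lambda>j. s i * s j * exp (?x i j))))
        - avg A (\<lambda>k. avg A (\<lambda>i. avg A (\<lambda>j. s i * s j * exp (?x i j + ?y i j k))))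
        + avg A (\<lambda>k. avg A (\<lambda>i. avg A (\<lambda>j. s i * s j * ?y i j k)))"
    unfolding has_bochner_integral_integral_eq[OF D_squared_integral]
      has_bochner_integral_integral_eq[OF G_D_squared_integral] lin avg_const[OF fin] by simp
  also have "\<dots> = avg A (\<lambda>k. avg A (\<lambda>i. avg A (\<lambda>j.
      s i * s j * (exp (?x i j) - exp (?x i j + ?y i j k) + ?y i j k))))"
    by (simp only: distrib_left right_diff_distrib avg_diff avg_add)
  also have "\<bar>\<dots>\<bar> \<le> 40 * q\<^sup>2"
  proof (rule order_trans[OF abs_avg_le], intro avg_le fin, rule order_trans[OF abs_avg_le],
      intro avg_le fin, rule order_trans[OF abs_avg_le], intro avg_le fin)
    fix k i j assume ijk: "k \<in> A" "i \<in> A" "j \<in> A"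
    have x: "\<bar>?x i j\<bar> \<le> 2 * q" "\<bar>?x i k\<bar> \<le> 2 * q" "\<bar>?x j k\<bar> \<le> 2 * q"
      using correlation_le ijk by blast+
    moreover have "?y i j k = ?x i k + ?x j k" by (simp add: distrib_left add_divide_distrib)
    ultimately have y: "\<bar>?x i j + ?y i j k\<bar> \<le> 6 * q" by linarith
    have "\<bar>exp (?x i j) - 1 - ?x i j\<bar> \<le> (?x i j)\<^sup>2"
      using x q by (intro abs_exp_minus_le) linarith
    moreover have "(?x i j)\<^sup>2 \<le> (2 * q)\<^sup>2"
      using x q_nonneg by (simp only: abs_le_square_iff[symmetric])
    moreover have "\<bar>exp (?x i j + ?y i j k) - 1 - (?x i j + ?y i j k)\<bar> \<le> (?x i j + ?y i j k)\<^sup>2"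
      using y q by (intro abs_exp_minus_le) linarith
    moreover have "(?x i j + ?y i j k)\<^sup>2 \<le> (6 * q)\<^sup>2"
      using y q_nonneg by (simp only: abs_le_square_iff[symmetric])
    moreover have "(2 * q)\<^sup>2 = 4 * q\<^sup>2" "(6 * q)\<^sup>2 = 36 * q\<^sup>2" by (simp_all add: power_mult_distrib)
    ultimately have "\<bar>exp (?x i j) - exp (?x i j + ?y i j k) + ?y i j k\<bar> \<le> 40 * q\<^sup>2" by linarith
    then show "\<bar>s i * s j * (exp (?x i j) - exp (?x i j + ?y i j k) + ?y i j k)\<bar> \<le> 40 * q\<^sup>2"
      using abs_sign_mult_le[OF ijk(2,3), of "exp (?x i j) - exp (?x i j + ?y i j k) + ?y i j k"]
      by linarith
  qed
  finally show ?thesis .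
qed

text \<open>Arbitrary coefficients of modulus one cover both \<open>D\<close>, with the signs, and
  \<open>G - 1\<close>, with constant 1.\<close>

lemma fourth_moment_bound:
  assumes "\<And>i. i \<in> A \<Longrightarrow> \<bar>c i\<bar> = 1"
  shows "integrable (noise_law N0) (\<lambda>y. avg A (\<lambda>i. c i * (tilt N0 (a i) y - 1)) ^ 4)"
    and "(\<integral>y. avg A (\<lambda>i. c i * (tilt N0 (a i) y - 1)) ^ 4 \<partial>noise_law N0) \<le> 168 * q\<^sup>2"
proof -
  have p: "0 \<le> a i \<bullet> a i / N0" "a i \<bullet> a i / N0 \<le> q" if "i \<in> A" for i
    using signal[OF that] N0 by (auto simp: field_simps)
  have "a i \<bullet> a i / N0 \<le> 1 / 12" if "i \<in> A" for i using p(2)[OF that] q by linarith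
  note m = tilt_fourth_moment[OF N0 this]
  have le: "avg A (\<lambda>i. c i * (tilt N0 (a i) y - 1)) ^ 4 \<le> avg A (\<lambda>i. (tilt N0 (a i) y - 1) ^ 4)" for y
  proof -
    have c: "c i ^ 4 = 1" if "i \<in> A" for i
      using assms[OF that] power_even_abs[of 4 "c i"] by simp
    show ?thesis using avg_power4_le[OF fin, of "\<lambda>i. c i * (tilt N0 (a i) y - 1)"]
      by (simp add: power_mult_distrib c cong: avg_cong)
  qed
  have int: "integrable (noise_law N0) (\<lambda>y. avg A (\<lambda>i. (tilt N0 (a i) y - 1) ^ 4))"
    by (intro integral_avg m)
  show 1: "integrable (noise_law N0) (\<lambda>y. avg A (\<lambda>i. c i * (tilt N0 (a i) y - 1)) ^ 4)"
  proof (rule Bochner_Integration.integrable_bound[OF int])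
    show "AE y in noise_law N0. norm (avg A (\<lambda>i. c i * (tilt N0 (a i) y - 1)) ^ 4)
        \<le> norm (avg A (\<lambda>i. (tilt N0 (a i) y - 1) ^ 4))"
      using le by (intro AE_I2) (simp add: order_trans[OF _ abs_ge_self])
  qed (unfold avg_def, measurable)
  have "(\<integral>y. avg A (\<lambda>i. c i * (tilt N0 (a i) y - 1)) ^ 4 \<partial>noise_law N0)
      \<le> (\<integral>y. avg A (\<lambda>i. (tilt N0 (a i) y - 1) ^ 4) \<partial>noise_law N0)"
    by (rule integral_mono[OF 1 int le])
  also have "\<dots> = avg A (\<lambda>i. \<integral>y. (tilt N0 (a i) y - 1) ^ 4 \<partial>noise_law N0)"
    by (intro integral_avg m)
  also have "\<dots> \<le> 168 * q\<^sup>2"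
  proof (intro avg_le fin)
    fix i assume i: "i \<in> A"
    have "(a i \<bullet> a i / N0)\<^sup>2 \<le> q\<^sup>2" using p[OF i] by (intro power_mono)
    then show "(\<integral>y. (tilt N0 (a i) y - 1) ^ 4 \<partial>noise_law N0) \<le> 168 * q\<^sup>2"
      using m(2)[OF i] by linarith
  qed
  finally show "(\<integral>y. avg A (\<lambda>i. c i * (tilt N0 (a i) y - 1)) ^ 4 \<partial>noise_law N0) \<le> 168 * q\<^sup>2" .
qed

lemma fourth_moments:
  "integrable (noise_law N0) (\<lambda>y. (D y) ^ 4)" "(\<integral>y. (D y) ^ 4 \<partial>noise_law N0) \<le> 168 * q\<^sup>2"
  "integrable (noise_law N0) (\<lambda>y. (G y - 1) ^ 4)" "(\<integral>y. (G y - 1) ^ 4 \<partial>noise_law N0) \<le> 168 * q\<^sup>2"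
proof -
  \<comment> \<open>Subtracting 1 from each tilt changes nothing, as the signs average to
    zero.\<close>
  have "D y = avg A (\<lambda>i. s i * (tilt N0 (a i) y - 1))" for y
    by (simp add: D_def right_diff_distrib avg_diff avg_sign)
  then show "integrable (noise_law N0) (\<lambda>y. (D y) ^ 4)" "(\<integral>y. (D y) ^ 4 \<partial>noise_law N0) \<le> 168 * q\<^sup>2"
    using fourth_moment_bound[OF sign_abs] by simp_all
  have "G y - 1 = avg A (\<lambda>i. 1 * (tilt N0 (a i) y - 1))" for y
    by (simp add: G_def avg_diff avg_const[OF fin])
  then show "integrable (noise_law N0) (\<lambda>y. (G y - 1) ^ 4)"
      "(\<integral>y. (G y - 1) ^ 4 \<partial>noise_law N0) \<le> 168 * q\<^sup>2"
    using fourth_moment_bound[of "\<lambda>_. 1"] by simp_all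
qed

text \<open>In \<open>exp x \<ge> 1 + x\<close> the part linear in \<open>y\<close> averages to zero
  since the signals sum to zero, so \<open>G\<close> is at least \<open>1 - q\<close> at every
  output. This makes the divisions by \<open>G\<close> harmless.\<close>

lemma G_ge_half: "1 / 2 \<le> G y"
proof -
  have "1 - q = avg A (\<lambda>i. 1 + 2 / N0 * (a i \<bullet> y) - q)"
    by (simp only: avg_add avg_diff avg_cmult avg_inner avg_const[OF fin])
  also have "\<dots> \<le> G y"
    unfolding G_def
  proof (rule avg_mono)
    fix i assume "i \<in> A"
    have "1 + 2 / N0 * (a i \<bullet> y) - q \<le> 1 + (2 * (a i \<bullet> y) - a i \<bullet> a i) / N0"
      using signal[OF \<open>i \<in> A\<close>] N0 by (simp add: field_simps)
    also have "\<dots> \<le> tilt N0 (a i) y" unfolding tilt_def by (rule exp_ge_add_one_self)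
    finally show "1 + 2 / N0 * (a i \<bullet> y) - q \<le> tilt N0 (a i) y" .
  qed
  finally show ?thesis using q by simp
qed

end
end

section \<open>Expansion of the information of one bit\<close>

context balanced_signals begin

text \<open>The integrand is squeezed between \<open>Q\<close> and \<open>Q\<close> plus fourth
  powers of small quantities. The constant 1400 rounds up
  \<open>22 + 4 * (168 + 168)\<close>.\<close>

lemma info_small:
  assumes signal: "\<And>i. i \<in> A \<Longrightarrow> a i \<bullet> a i \<le> q * N0" and q: "q \<le> 1/12"
  shows "\<bar>info - v \<bullet> v / N0\<bar> \<le> 1400 * q\<^sup>2"
proof -
  note m = fourth_moments[OF signal q]
  have i2: "integrable (noise_law N0) (\<lambda>y. (D y)\<^sup>2)" "integrable (noise_law N0) (\<lambda>y. G y * (D y)\<^sup>2)"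
    using D_squared_integral G_D_squared_integral by (auto simp: has_bochner_integral_iff)
  \<comment> \<open>\<open>Q\<close> is \<open>D\<^sup>2 / (2 * G)\<close> with \<open>1 / G\<close> replaced by its linearisation \<open>2 - G\<close> at \<open>1\<close>; the error is \<open>D\<^sup>2 * (1 - G)\<^sup>2 / (2 * G)\<close>.\<close>
  define Q where "Q y = (D y)\<^sup>2 - G y * (D y)\<^sup>2 / 2" for y
  have iQ: "integrable (noise_law N0) Q"
    unfolding Q_def using i2 by simp
  have EQ: "(\<integral>y. Q y \<partial>noise_law N0)
      = (\<integral>y. (D y)\<^sup>2 \<partial>noise_law N0) - (\<integral>y. G y * (D y)\<^sup>2 \<partial>noise_law N0) / 2"
    unfolding Q_def using i2 by simp
  \<comment> \<open>The integral of \<open>Q\<close> is half the second moment of \<open>D\<close>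
    plus half the difference estimated in \<open>mixed_moment_bound\<close>, so the error is
    \<open>4 / 2 + 40 / 2\<close>.\<close>
  have Q: "\<bar>(\<integral>y. Q y \<partial>noise_law N0) - v \<bullet> v / N0\<bar> \<le> 22 * q\<^sup>2"
    using D_squared_bound[OF signal q] mixed_moment_bound[OF signal q]
    unfolding EQ abs_le_iff by simp
  have lower: "Q y \<le> G y * F (D y / G y)" for y
  proof -
    have g: "0 < G y" by (rule G_pos)
    have "0 \<le> (D y)\<^sup>2 * (1 - G y)\<^sup>2 / (2 * G y)" using g by simp
    also have "\<dots> = (D y)\<^sup>2 / (2 * G y) - Q y"
      using g by (simp add: Q_def field_simps power2_eq_square)
    also have "(D y)\<^sup>2 / (2 * G y) = G y * ((D y / G y)\<^sup>2 / 2)"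
      using g by (simp add: power2_eq_square)
    also have "\<dots> \<le> G y * F (D y / G y)"
      using symmetrised_entropy_bounds(1)[OF abs_ratio, of y] g unfolding F_def
      by (intro mult_left_mono) auto
    finally show ?thesis by simp
  qed
  have upper: "G y * F (D y / G y) \<le> Q y + 4 * ((D y) ^ 4 + (G y - 1) ^ 4)" for y
  proof -
    have g: "0 < G y" by (rule G_pos)
    have h: "1 / 2 \<le> G y" by (rule G_ge_half[OF signal q])
    have "G y * F (D y / G y) \<le> G y * ((D y / G y)\<^sup>2 / 2 + (D y / G y) ^ 4 / 3)"
      using symmetrised_entropy_bounds(2)[OF abs_ratio, of y] g unfolding F_def
      by (intro mult_left_mono) auto
    also have "\<dots> = (D y)\<^sup>2 / (2 * G y) + (D y) ^ 4 / (3 * (G y) ^ 3)"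
      using g by (simp add: field_simps eval_nat_numeral)
    also have "(D y)\<^sup>2 / (2 * G y) = Q y + (D y)\<^sup>2 * (G y - 1)\<^sup>2 * (1 / (2 * G y))"
      using g by (simp add: Q_def field_simps power2_eq_square)
    also have "(D y)\<^sup>2 * (G y - 1)\<^sup>2 * (1 / (2 * G y)) \<le> (D y)\<^sup>2 * (G y - 1)\<^sup>2 * 1"
      using h by (intro mult_left_mono) (auto simp: field_simps)
    also have "(D y)\<^sup>2 * (G y - 1)\<^sup>2 * 1 \<le> (D y) ^ 4 + (G y - 1) ^ 4"
    proof -
      have "x * z \<le> x\<^sup>2 + z\<^sup>2" for x z :: real
        using sum_squares_bound[of x z] zero_le_power2[of x] zero_le_power2[of z]
        unfolding mult.assoc by linarith
      from this[of "(D y)\<^sup>2" "(G y - 1)\<^sup>2"] show ?thesis by simp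
    qed
    also have "(D y) ^ 4 / (3 * (G y) ^ 3) \<le> (D y) ^ 4 * 3"
    proof -
      \<comment> \<open>The value \<open>1/8\<close> is weakened to \<open>1/9\<close> to obtain the
        round factor 3.\<close>
      have "(1 / 2) ^ 3 \<le> (G y) ^ 3" using h by (intro power_mono) auto
      then have "1 / 9 \<le> (G y) ^ 3" by (simp add: eval_nat_numeral)
      then have "(D y) ^ 4 * 1 \<le> (D y) ^ 4 * (9 * (G y) ^ 3)"
        by (intro mult_left_mono) auto
      then show ?thesis using g by (simp add: field_simps)
    qed
    finally have "G y * F (D y / G y) \<le> Q y + ((D y) ^ 4 + (G y - 1) ^ 4) + (D y) ^ 4 * 3" by simp
    moreover have "0 \<le> (G y - 1) ^ 4" by simp
    ultimately show ?thesis unfolding distrib_left by linarith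
  qed
  have iU: "integrable (noise_law N0) (\<lambda>y. Q y + 4 * ((D y) ^ 4 + (G y - 1) ^ 4))"
    using iQ m by simp
  have "(\<integral>y. Q y \<partial>noise_law N0) \<le> info"
    unfolding info_eq by (rule integral_mono[OF iQ integrable_F lower])
  moreover have "info \<le> (\<integral>y. Q y \<partial>noise_law N0)
      + 4 * (\<integral>y. (D y) ^ 4 \<partial>noise_law N0) + 4 * (\<integral>y. (G y - 1) ^ 4 \<partial>noise_law N0)"
  proof -
    have "info \<le> (\<integral>y. Q y + 4 * ((D y) ^ 4 + (G y - 1) ^ 4) \<partial>noise_law N0)"
      unfolding info_eq by (rule integral_mono[OF integrable_F iU upper])
    then show ?thesis using iQ m by simp
  qed
  moreover have "(\<integral>y. (D y) ^ 4 \<partial>noise_law N0) \<le> 168 * q\<^sup>2"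
      "(\<integral>y. (G y - 1) ^ 4 \<partial>noise_law N0) \<le> 168 * q\<^sup>2"
    using m(2,4) by blast+
  moreover have "(\<integral>y. Q y \<partial>noise_law N0) \<le> v \<bullet> v / N0 + 22 * q\<^sup>2"
      "v \<bullet> v / N0 - 22 * q\<^sup>2 \<le> (\<integral>y. Q y \<partial>noise_law N0)"
    using Q unfolding abs_le_iff by linarith+
  ultimately show ?thesis using zero_le_power2[of q] unfolding abs_le_iff by linarith
qed

text \<open>Unbounded fading makes \<open>q\<close> large at any fixed \<open>N0\<close>, so the
  bound must hold for every \<open>q\<close>. Beyond \<open>1/12\<close> the error is at most
  \<open>1 + q\<close>, and there \<open>1 \<le> 144 * q^2\<close> and
  \<open>q \<le> 12 * q^2\<close>.\<close>

lemma info_expansion: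
  assumes signal: "\<And>i. i \<in> A \<Longrightarrow> a i \<bullet> a i \<le> q * N0"
  shows "\<bar>info - v \<bullet> v / N0\<bar> \<le> 1400 * q\<^sup>2"
proof (cases "q \<le> 1/12")
  case True
  then show ?thesis using info_small[OF signal] by blast
next
  case False
  have "v \<bullet> v / N0 \<le> q" using v_inner_le[OF signal] N0 by (simp add: field_simps)
  moreover have "0 \<le> v \<bullet> v / N0" using N0 by simp
  ultimately have "\<bar>info - v \<bullet> v / N0\<bar> \<le> 1 + q"
    using info_bounds False unfolding abs_le_iff by linarith
  also have "\<dots> \<le> 1400 * q\<^sup>2"
  proof -
    have "(1/12) * q \<le> q * q" "(1/12) * (1/12) \<le> q * q" using False by (intro mult_mono; simp)+
    then show ?thesis unfolding power2_eq_square by linarith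
  qed
  finally show ?thesis .
qed

end

section \<open>Coded bits and moments of the fading\<close>

lemma finite_words: "finite {bs :: bool list. length bs = m}"
  and card_words: "card {bs :: bool list. length bs = m} = 2 ^ m"
  and words_nonempty: "{bs :: bool list. length bs = m} \<noteq> {}"
proof -
  show "finite {bs :: bool list. length bs = m}"
    using finite_lists_length_eq[of "UNIV :: bool set" m] by simp
  show "card {bs :: bool list. length bs = m} = 2 ^ m"
    using card_lists_length_eq[of "UNIV :: bool set" m] by simp
  have "replicate m True \<in> {bs. length bs = m}" by simp
  then show "{bs :: bool list. length bs = m} \<noteq> {}" by blast
qed

lemma coded_bits_eq: "coded_bits m = pmf_of_set {bs. length bs = m}"
proof (rule pmf_eqI)
  have rep: "pmf (replicate_pmf n (bernoulli_pmf (1/2))) bs = (if length bs = n then 1 / 2 ^ n else 0)" for n bs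
  proof (induction n arbitrary: bs)
    case 0
    then show ?case by (simp add: pmf_return)
  next
    case (Suc n)
    have "replicate_pmf (Suc n) (bernoulli_pmf (1/2)) =
        map_pmf (\<lambda>(x, xs). x # xs) (pair_pmf (bernoulli_pmf (1/2)) (replicate_pmf n (bernoulli_pmf (1/2))))"
      by (simp add: pair_pmf_def map_bind_pmf map_pmf_def bind_assoc_pmf bind_return_pmf)
    moreover have "pmf (map_pmf (\<lambda>(x, xs). x # xs) (pair_pmf (bernoulli_pmf (1/2))
        (replicate_pmf n (bernoulli_pmf (1/2))))) bs = (if length bs = Suc n then 1 / 2 ^ Suc n else 0)"
    proof (cases bs)
      case Nil
      then show ?thesis by (auto simp: pmf_eq_0_set_pmf)
    next
      case (Cons b bs')
      have "inj (\<lambda>(x :: bool, xs). x # xs)" by (auto simp: inj_on_def)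
      from pmf_map_inj'[OF this, of _ "(b, bs')"] show ?thesis
        unfolding Cons by (simp add: pmf_pair Suc)
    qed
    ultimately show ?case by simp
  qed
  show "pmf (coded_bits m) bs = pmf (pmf_of_set {bs. length bs = m}) bs" for bs
    unfolding coded_bits_def rep using finite_words[of m] words_nonempty[of m] card_words[of m] by simp
qed

lemma expectation_coded_bits:
  "measure_pmf.expectation (coded_bits m) f = avg {bs. length bs = m} f"
  unfolding coded_bits_eq avg_def
  by (rule integral_pmf_of_set[OF words_nonempty finite_words])

text \<open>The first-order Walsh functions on the cube of words; as signs they have mean zero and
  are orthogonal.\<close>

definition bit_sign :: "nat \<Rightarrow> bool list \<Rightarrow> real" where
  "bit_sign k bs = (if bs ! k then 1 else - 1)"

text \<open>Flipping one bit is an involution of the words. It serves to annihilate sums that are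
  odd in a bit.\<close>

lemma sum_words_flip:
  fixes f :: "bool list \<Rightarrow> 'b::comm_monoid_add"
  shows "(\<Sum>bs | length bs = m. f (bs[k := \<not> bs ! k])) = (\<Sum>bs | length bs = m. f bs)"
proof (cases "k < m")
  case True
  show ?thesis
    by (rule sum.reindex_bij_witness[of _ "\<lambda>bs. bs[k := \<not> bs ! k]" "\<lambda>bs. bs[k := \<not> bs ! k]"])
       (use True in auto)
next
  case False
  then show ?thesis by (intro sum.cong) (auto simp: list_update_beyond)
qed

lemma sum_bit_sign:
  assumes "k < m"
  shows "(\<Sum>bs | length bs = m. bit_sign k bs) = 0"
proof -
  have "(\<Sum>bs | length bs = m. bit_sign k bs) = (\<Sum>bs | length bs = m. bit_sign k (bs[k := \<not> bs ! k]))"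
    by (rule sum_words_flip[symmetric])
  also have "\<dots> = (\<Sum>bs | length bs = m. - bit_sign k bs)"
    using assms by (intro sum.cong) (auto simp: bit_sign_def)
  finally show ?thesis by (simp add: sum_negf)
qed

text \<open>Conditioning on a bit amounts to weights 0 and 2 on all words. In this form the
  conditional output density splits into the parts \<open>G\<close> and
  \<open>\<plusminus> D\<close>.\<close>

lemma expectation_coded_bits_given_bit:
  assumes "k < m"
  shows "measure_pmf.expectation (cond_pmf (coded_bits m) {bs. bs ! k = b}) f
    = avg {bs. length bs = m} (\<lambda>bs. (1 + (if b then 1 else - 1) * bit_sign k bs) * f bs)"
proof -
  let ?A = "{bs :: bool list. length bs = m}" and ?e = "if b then 1 else - 1 :: real"
  let ?B = "?A \<inter> {bs. bs ! k = b}"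
  have e: "1 + ?e * bit_sign k bs = (if bs ! k = b then 2 else 0)" for bs
    by (auto simp: bit_sign_def)
  have sumB: "(\<Sum>bs\<in>?A. (1 + ?e * bit_sign k bs) * g bs) = 2 * (\<Sum>bs\<in>?B. g bs)" for g
    unfolding e sum_distrib_left
    by (rule sum.mono_neutral_cong_right) (auto simp: finite_words)
  \<comment> \<open>The weights with constant 1 show that exactly half of the words have the
    prescribed bit.\<close>
  have "2 * real (card ?B) = (\<Sum>bs\<in>?A. (1 + ?e * bit_sign k bs) * 1)"
    unfolding sumB by simp
  also have "\<dots> = real (card ?A)"
    using sum_bit_sign[OF assms] by (simp add: sum.distrib sum_distrib_left[symmetric])
  finally have card: "real (card ?A) = 2 * real (card ?B)" by simp
  have ne: "?B \<noteq> {}"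
  proof
    assume "?B = {}"
    then show False using card by (simp add: card_words)
  qed
  have "measure_pmf.expectation (cond_pmf (coded_bits m) {bs. bs ! k = b}) f
      = measure_pmf.expectation (pmf_of_set ?B) f"
  proof -
    have "cond_pmf (coded_bits m) {bs. bs ! k = b} = pmf_of_set ?B"
    proof (rule pmf_eqI)
      have "set_pmf (coded_bits m) \<inter> {bs. bs ! k = b} \<noteq> {}"
        using ne by (simp add: coded_bits_eq set_pmf_of_set[OF words_nonempty finite_words])
      then show "pmf (cond_pmf (coded_bits m) {bs. bs ! k = b}) bs = pmf (pmf_of_set ?B) bs" for bs
        using card ne
        by (simp add: pmf_cond coded_bits_eq pmf_of_set[OF words_nonempty finite_words] finite_words
            measure_pmf_of_set[OF words_nonempty finite_words] pmf_of_set card_words split: split_indicator)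
    qed
    then show ?thesis by simp
  qed
  also have "\<dots> = (\<Sum>bs\<in>?B. f bs) / real (card ?B)"
    by (rule integral_pmf_of_set) (use ne finite_words in auto)
  finally show ?thesis unfolding avg_def sumB card by simp
qed

section \<open>Moments from stretched-exponential tails\<close>

lemma summable_square_times_stretched_exp:
  assumes "0 < (w::real)"
  shows "summable (\<lambda>n. (real n + 1)\<^sup>2 * exp (- (real n powr w)))"
proof (rule summable_comparison_test_bigo)
  show "summable (\<lambda>n. norm (1 / real n ^ 2))"
    using inverse_power_summable[of 2, where 'a = real] by (simp add: divide_inverse)
  show "(\<lambda>n. (real n + 1)\<^sup>2 * exp (- (real n powr w))) \<in> O(\<lambda>n. 1 / real n ^ 2)"
    using assms by real_asymp
qed

text \<open>The square of \<open>X\<close> is at most the sum of \<open>(n + 1)^2\<close> over all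
  \<open>n < X\<close>, so its integral is bounded by a series of tail probabilities. With the
  squared norm of the fading as \<open>X\<close> this yields the fourth moment.\<close>

lemma integrable_power2_of_tail:
  fixes X :: "'a \<Rightarrow> real"
  assumes "prob_space M" and X [measurable]: "X \<in> borel_measurable M" and nn: "\<And>x. 0 \<le> X x"
    and "0 < w" and tail: "\<forall>\<^sub>F d in at_top. measure M {x \<in> space M. d < X x} \<le> exp (- (d powr w))"
  shows "integrable M (\<lambda>x. (X x)\<^sup>2)"
proof (rule integrableI_bounded)
  interpret prob_space M by fact
  let ?p = "\<lambda>n::nat. measure M {x \<in> space M. real n < X x}"
  have "\<forall>\<^sub>F n in sequentially. ?p n \<le> exp (- (real n powr w))"
    using eventually_compose_filterlim[OF tail filterlim_real_sequentially] .
  then have "\<forall>\<^sub>F n in sequentially. norm ((real n + 1)\<^sup>2 * ?p n) \<le> (real n + 1)\<^sup>2 * exp (- (real n powr w))"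
    by eventually_elim (simp add: mult_left_mono)
  then have sum: "summable (\<lambda>n. (real n + 1)\<^sup>2 * ?p n)"
    by (rule summable_comparison_test_ev) (rule summable_square_times_stretched_exp[OF \<open>0 < w\<close>])
  have pw: "ennreal ((X x)\<^sup>2)
      \<le> (\<Sum>n. ennreal ((real n + 1)\<^sup>2) * indicator {x \<in> space M. real n < X x} x)"
    if x: "x \<in> space M" for x
  proof (cases "X x = 0")
    case False
    with nn[of x] have pos: "0 < X x" by simp
    define g where "g n = ennreal ((real n + 1)\<^sup>2) * indicator {x \<in> space M. real n < X x} x" for n :: nat
    \<comment> \<open>The \<open>n\<close> with \<open>n < X x \<le> n + 1\<close>; the left
      inequality is strict because the tail events are.\<close>
    define n where "n = nat (\<lceil>X x\<rceil> - 1)"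
    have n: "real n < X x" "X x \<le> real n + 1"
      using pos by (auto simp: n_def) linarith+
    then have "(X x)\<^sup>2 \<le> (real n + 1)\<^sup>2" using pos by (intro power_mono) auto
    then have "ennreal ((X x)\<^sup>2) \<le> g n"
      using n x by (simp add: g_def ennreal_leI)
    also have "g n = sum g {n}" by simp
    also have "\<dots> \<le> (\<Sum>n. g n)" by (rule sum_le_suminf) auto
    finally show ?thesis unfolding g_def .
  qed simp
  have "(\<integral>\<^sup>+x. ennreal (norm ((X x)\<^sup>2)) \<partial>M)
      \<le> (\<integral>\<^sup>+x. (\<Sum>n. ennreal ((real n + 1)\<^sup>2) * indicator {x \<in> space M. real n < X x} x) \<partial>M)"
    using pw by (intro nn_integral_mono) simp
  also have "\<dots> = (\<Sum>n. \<integral>\<^sup>+x. ennreal ((real n + 1)\<^sup>2) * indicator {x \<in> space M. real n < X x} x \<partial>M)"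
    by (rule nn_integral_suminf) measurable
  also have "\<dots> = (\<Sum>n. ennreal ((real n + 1)\<^sup>2 * ?p n))"
    by (simp add: nn_integral_cmult_indicator emeasure_eq_measure ennreal_mult')
  also have "\<dots> < \<infinity>"
    using sum by (subst suminf_ennreal2) (auto simp: less_top)
  finally show "(\<integral>\<^sup>+x. ennreal (norm ((X x)\<^sup>2)) \<partial>M) < \<infinity>" .
qed measurable

text \<open>The fourth moment controls the error of the expansion, the component-wise second moments
  give its leading term.\<close>

lemma fading_moments:
  fixes \<mu> :: "(real^'n) measure"
  assumes "fading_law \<mu> \<nu>"
  shows "integrable \<mu> (\<lambda>h. (h \<bullet> h)\<^sup>2)"
    and "has_bochner_integral \<mu> (\<lambda>h. (h $ j)\<^sup>2) (\<integral>t. t\<^sup>2 \<partial>\<nu>)"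
proof -
  have prob: "prob_space \<mu>" and sets [measurable_cong]: "sets \<mu> = sets borel"
    and \<nu>: "distr \<mu> borel (\<lambda>h. h $ j) = \<nu>" and int: "integrable \<nu> (\<lambda>t. t\<^sup>2)"
    using assms by (auto simp: fading_law_def)
  obtain w where w: "0 < w" "\<forall>\<^sub>F d in at_top. measure \<mu> {h. d < (norm h)\<^sup>2} \<le> exp (- (d powr w))"
    using assms by (auto simp: fading_law_def)
  have [simp]: "space \<mu> = UNIV" using sets_eq_imp_space_eq[OF sets] by simp
  show "integrable \<mu> (\<lambda>h. (h \<bullet> h)\<^sup>2)"
  proof (rule integrable_power2_of_tail[OF prob _ _ w(1)])
    show "(\<lambda>h. h \<bullet> h) \<in> borel_measurable \<mu>" by measurable
    show "\<forall>\<^sub>F d in at_top. measure \<mu> {h \<in> space \<mu>. d < h \<bullet> h} \<le> exp (- (d powr w))"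
      using w(2) by (simp add: power2_norm_eq_inner)
  qed simp
  have [measurable]: "(\<lambda>h. h $ j) \<in> borel_measurable \<mu>"
    using vec_nth_measurable measurable_cong_sets[OF sets refl] by blast
  show "has_bochner_integral \<mu> (\<lambda>h. (h $ j)\<^sup>2) (\<integral>t. t\<^sup>2 \<partial>\<nu>)"
    using int unfolding \<nu>[symmetric] has_bochner_integral_iff
    by (simp add: integral_distr integrable_distr_eq)
qed

section \<open>Low-SNR expansion of the capacity\<close>

lemma inner_mult_vec_le:
  fixes h x :: "real^'n"
  assumes "x \<bullet> x \<le> R"
  shows "(h * x) \<bullet> (h * x) \<le> (h \<bullet> h) * R"
proof -
  have "(x $ j)\<^sup>2 \<le> R" for j
    using member_le_sum[of j UNIV "\<lambda>j. (x $ j)\<^sup>2"] assms by (simp add: inner_vec_def power2_eq_square)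
  then have "(\<Sum>j\<in>UNIV. (h $ j)\<^sup>2 * (x $ j)\<^sup>2) \<le> (\<Sum>j\<in>UNIV. (h $ j)\<^sup>2 * R)"
    by (intro sum_mono mult_left_mono) auto
  then show ?thesis
    unfolding inner_vec_def sum_distrib_right by (simp add: power2_eq_square mult_ac)
qed

lemma mult_vec_measurable [measurable]: "(\<lambda>h::real^'n. h * u) \<in> borel_measurable borel"
proof -
  have "linear (\<lambda>h::real^'n. h * u)"
    by (rule linearI) (simp_all add: vec_eq_iff algebra_simps)
  then show ?thesis
    by (intro borel_measurable_continuous_onI linear_continuous_on) (simp add: linear_conv_bounded_linear)
qed

text \<open>Any alphabet of zero mean, with \<open>R\<close> a bound on the symbol energies. The
  zero mean is what cancels the linear terms at fixed fading.\<close>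

locale bicm_channel =
  fixes m :: nat and X :: "nat \<Rightarrow> real^'n" and L :: "nat \<Rightarrow> bool list"
    and \<mu> :: "(real^'n) measure" and \<nu> :: "real measure" and R :: real
  assumes fading: "fading_law \<mu> \<nu>"
    and mean_zero: "(\<Sum>bs | length bs = m. symbol m X L bs) = 0"
    and bounded: "\<And>bs. length bs = m \<Longrightarrow> symbol m X L bs \<bullet> symbol m X L bs \<le> R"
begin

abbreviation words :: "bool list set" where "words \<equiv> {bs. length bs = m}"
abbreviation sym :: "bool list \<Rightarrow> real^'n" where "sym \<equiv> symbol m X L"

text \<open>For \<open>k < m\<close> this is half the difference of the mean symbols given the two
  values of bit \<open>k\<close>.\<close>

definition bit_mean :: "nat \<Rightarrow> real^'n" where
  "bit_mean k = (1 / real (card words)) *\<^sub>R (\<Sum>bs\<in>words. bit_sign k bs *\<^sub>R sym bs)"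

lemma sets_fading [measurable_cong]: "sets \<mu> = sets borel"
  using fading by (simp add: fading_law_def)

sublocale fade: prob_space \<mu>
  using fading by (simp add: fading_law_def)

lemma balanced:
  assumes "k < m" "0 < N0"
  shows "balanced_signals words (bit_sign k) (\<lambda>bs. h * sym bs) N0"
proof
  have "(\<Sum>bs\<in>words. h * sym bs) = h * (\<Sum>bs\<in>words. sym bs)"
    by (simp add: vec_eq_iff sum_distrib_left)
  also have "\<dots> = 0" using mean_zero by (simp add: vec_eq_iff)
  finally show "(\<Sum>bs\<in>words. h * sym bs) = 0" .
qed (use assms sum_bit_sign in \<open>auto simp: finite_words bit_sign_def intro: Ex_list_of_length\<close>)

definition bit_density where
  "bit_density N0 k bs h y = log 2 (output_density_given_bit m X L N0 k (bs ! k) h y / output_density m X L N0 h y)"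

text \<open>The noise density is a common factor of numerator and denominator and cancels; division
  by \<open>ln 2\<close> converts nats to bits.\<close>

lemma bit_density_eq:
  assumes "k < m" "0 < N0"
  shows "bit_density N0 k bs h y = ln (1 + bit_sign k bs *
    (balanced_signals.D words (bit_sign k) (\<lambda>bs. h * sym bs) N0 y /
     balanced_signals.G words (\<lambda>bs. h * sym bs) N0 y)) / ln 2"
proof -
  interpret B: balanced_signals words "bit_sign k" "\<lambda>bs. h * sym bs" N0 by (rule balanced[OF assms])
  have "output_density m X L N0 h y = noise_density N0 y * B.G y"
    unfolding output_density_def expectation_coded_bits B.G_def
    by (simp only: noise_density_shift[OF assms(2)] avg_cmult)
  moreover have "output_density_given_bit m X L N0 k (bs ! k) h y
      = noise_density N0 y * (B.G y + bit_sign k bs * B.D y)"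
  proof -
    have "output_density_given_bit m X L N0 k (bs ! k) h y = avg words (\<lambda>ws.
        noise_density N0 y * (tilt N0 (h * sym ws) y
          + bit_sign k bs * (bit_sign k ws * tilt N0 (h * sym ws) y)))"
      unfolding output_density_given_bit_def expectation_coded_bits_given_bit[OF assms(1)]
        noise_density_shift[OF assms(2)] bit_sign_def[of k bs]
      by (intro avg_cong) (simp add: algebra_simps)
    then show ?thesis by (simp only: avg_cmult avg_add B.G_def B.D_def)
  qed
  ultimately show ?thesis
    using noise_density_pos[OF assms(2), of y] B.G_pos[of y]
    by (simp add: bit_density_def log_def add_divide_distrib)
qed

lemma shifted_noise_density_measurable:
  fixes u w :: "real^'n"
  shows "(\<lambda>p. noise_density N0 (fst p * u + snd p - fst p * w))
    \<in> borel_measurable (\<mu> \<Otimes>\<^sub>M noise_law N0)"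
proof -
  have [measurable]: "fst \<in> borel_measurable (\<mu> \<Otimes>\<^sub>M noise_law N0)"
      "snd \<in> borel_measurable (\<mu> \<Otimes>\<^sub>M noise_law N0)"
    using measurable_fst[of \<mu> "noise_law N0"] measurable_snd[of \<mu> "noise_law N0"]
      measurable_cong_sets[OF refl sets_fading] measurable_cong_sets[OF refl sets_noise_law] by blast+
  have "(\<lambda>p. fst p * u + snd p - fst p * w) \<in> borel_measurable (\<mu> \<Otimes>\<^sub>M noise_law N0)"
    by (intro borel_measurable_diff borel_measurable_add measurable_compose[OF _ mult_vec_measurable])
       measurable
  from measurable_compose[OF this noise_density_measurable] show ?thesis .
qed

lemma bit_density_measurable:
  assumes "k < m"
  shows "(\<lambda>(h, z). bit_density N0 k bs h (h * sym bs + z))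
    \<in> borel_measurable (\<mu> \<Otimes>\<^sub>M noise_law N0)"
  unfolding bit_density_def output_density_def output_density_given_bit_def
    expectation_coded_bits expectation_coded_bits_given_bit[OF assms] avg_def case_prod_beta log_def
  by (intro borel_measurable_divide borel_measurable_ln borel_measurable_sum borel_measurable_times
      borel_measurable_const shifted_noise_density_measurable)

context
  fixes N0 :: real and k :: nat
  assumes k: "k < m" and N0: "0 < N0"
begin

interpretation noise: prob_space "noise_law N0 :: (real^'n) measure"
  by (rule prob_space_noise_law[OF N0])
interpretation hz: pair_prob_space \<mu> "noise_law N0 :: (real^'n) measure" ..
interpretation all: pair_prob_space "measure_pmf (coded_bits m)" "\<mu> \<Otimes>\<^sub>M (noise_law N0 :: (real^'n) measure)" ..

definition cond_info where
  "cond_info h = balanced_signals.info words (bit_sign k) (\<lambda>bs. h * sym bs) N0"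

lemma bit_density_fibre:
  assumes "bs \<in> words"
  shows "integrable (noise_law N0) (\<lambda>z. bit_density N0 k bs h (h * sym bs + z))"
    and "(\<integral>z. \<bar>bit_density N0 k bs h (h * sym bs + z)\<bar> \<partial>noise_law N0) \<le> 2 * 2 ^ m / ln 2"
proof -
  interpret B: balanced_signals words "bit_sign k" "\<lambda>bs. h * sym bs" N0 by (rule balanced[OF k N0])
  show "integrable (noise_law N0) (\<lambda>z. bit_density N0 k bs h (h * sym bs + z))"
    unfolding bit_density_eq[OF k N0] using B.information_density_integrable(1)[OF assms] by simp
  show "(\<integral>z. \<bar>bit_density N0 k bs h (h * sym bs + z)\<bar> \<partial>noise_law N0) \<le> 2 * 2 ^ m / ln 2"
    unfolding bit_density_eq[OF k N0] using B.information_density_integrable(2)[OF assms]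
    by (simp add: abs_divide divide_right_mono card_words)
qed

text \<open>The integrals of the modulus over the noise are bounded by a constant not depending on
  \<open>h\<close>, hence integrable over the probability measure \<open>\<mu>\<close>, and Fubini's
  theorem applies.\<close>

lemma bit_density_integrable:
  assumes "bs \<in> words"
  shows "integrable (\<mu> \<Otimes>\<^sub>M noise_law N0) (\<lambda>(h, z). bit_density N0 k bs h (h * sym bs + z))"
proof (rule hz.Fubini_integrable)
  note meas = bit_density_measurable[OF k, of N0 bs, measurable]
  show "(\<lambda>(h, z). bit_density N0 k bs h (h * sym bs + z)) \<in> borel_measurable (\<mu> \<Otimes>\<^sub>M noise_law N0)"
    by (rule meas)
  show "integrable \<mu> (\<lambda>h. \<integral>z. norm (case (h, z) of (h, z) \<Rightarrow> bit_density N0 k bs h (h * sym bs + z)) \<partial>noise_law N0)"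
  proof (rule fade.integrable_const_bound[where B = "2 * 2 ^ m / ln 2"])
    show "AE h in \<mu>. norm (\<integral>z. norm (case (h, z) of (h, z) \<Rightarrow> bit_density N0 k bs h (h * sym bs + z)) \<partial>noise_law N0)
        \<le> 2 * 2 ^ m / ln 2"
      using bit_density_fibre(2)[OF assms] by (intro AE_I2) simp
    show "(\<lambda>h. \<integral>z. norm (case (h, z) of (h, z) \<Rightarrow> bit_density N0 k bs h (h * sym bs + z)) \<partial>noise_law N0)
        \<in> borel_measurable \<mu>"
      using meas by measurable
  qed
  show "AE h in \<mu>. integrable (noise_law N0) (\<lambda>z. case (h, z) of (h, z) \<Rightarrow> bit_density N0 k bs h (h * sym bs + z))"
    using bit_density_fibre(1)[OF assms] by simp
qed

lemma capacity_term:
  "integrable \<mu> cond_info"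
  "(\<integral>(bs, h, z). bit_density N0 k bs h (h * sym bs + z)
      \<partial>(measure_pmf (coded_bits m) \<Otimes>\<^sub>M (\<mu> \<Otimes>\<^sub>M noise_law N0))) = (\<integral>h. cond_info h \<partial>\<mu>) / ln 2"
proof -
  let ?f = "\<lambda>(bs, h, z). bit_density N0 k bs h (h * sym bs + z)"
  have set: "set_pmf (coded_bits m) = words"
    by (simp add: coded_bits_eq set_pmf_of_set[OF words_nonempty finite_words])
  have meas: "?f \<in> borel_measurable (measure_pmf (coded_bits m) \<Otimes>\<^sub>M (\<mu> \<Otimes>\<^sub>M noise_law N0))"
  proof -
    \<comment> \<open>The words are countable and carry the discrete structure, so measurability is
      checked for each word separately.\<close>
    have "?f \<in> borel_measurable (count_space UNIV \<Otimes>\<^sub>M (\<mu> \<Otimes>\<^sub>M noise_law N0))"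
    proof (rule measurable_pair_measure_countable1)
      show "(\<lambda>y. ?f (bs, y)) \<in> borel_measurable (\<mu> \<Otimes>\<^sub>M noise_law N0)" for bs
        using bit_density_measurable[OF k, of N0 bs] by simp
    qed simp
    moreover have eq: "sets (measure_pmf (coded_bits m) \<Otimes>\<^sub>M (\<mu> \<Otimes>\<^sub>M noise_law N0))
        = sets (count_space UNIV \<Otimes>\<^sub>M (\<mu> \<Otimes>\<^sub>M noise_law N0))"
      by (rule sets_pair_measure_cong) simp_all
    ultimately show ?thesis by (subst measurable_cong_sets[OF eq refl])
  qed
  have int: "integrable (measure_pmf (coded_bits m) \<Otimes>\<^sub>M (\<mu> \<Otimes>\<^sub>M noise_law N0)) ?f"
  proof (rule all.Fubini_integrable[OF meas])
    show "integrable (measure_pmf (coded_bits m)) (\<lambda>x. \<integral>y. norm (?f (x, y)) \<partial>(\<mu> \<Otimes>\<^sub>M noise_law N0))"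
      by (rule integrable_measure_pmf_finite) (simp add: set finite_words)
    show "AE x in measure_pmf (coded_bits m). integrable (\<mu> \<Otimes>\<^sub>M noise_law N0) (\<lambda>y. ?f (x, y))"
      using bit_density_integrable by (simp add: AE_measure_pmf_iff set)
  qed
  have fst: "integrable \<mu> (\<lambda>h. \<integral>z. bit_density N0 k bs h (h * sym bs + z) \<partial>noise_law N0)"
      "(\<integral>hz. (case hz of (h, z) \<Rightarrow> bit_density N0 k bs h (h * sym bs + z)) \<partial>(\<mu> \<Otimes>\<^sub>M noise_law N0))
        = (\<integral>h. \<integral>z. bit_density N0 k bs h (h * sym bs + z) \<partial>noise_law N0 \<partial>\<mu>)" if "bs \<in> words" for bs
    using hz.integrable_fst'[OF bit_density_integrable[OF that]]
      hz.integral_fst'[OF bit_density_integrable[OF that]] by simp_all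
  have info: "avg words (\<lambda>bs. \<integral>z. bit_density N0 k bs h (h * sym bs + z) \<partial>noise_law N0)
      = cond_info h / ln 2" for h
  proof -
    interpret B: balanced_signals words "bit_sign k" "\<lambda>bs. h * sym bs" N0 by (rule balanced[OF k N0])
    show ?thesis
      unfolding cond_info_def B.info_def bit_density_eq[OF k N0]
      by (simp add: divide_inverse avg_multc)
  qed
  have avg: "integrable \<mu> (\<lambda>h. avg words (\<lambda>bs. \<integral>z. bit_density N0 k bs h (h * sym bs + z) \<partial>noise_law N0))"
    by (intro integral_avg fst)
  then have "integrable \<mu> (\<lambda>h. cond_info h / ln 2 * ln 2)"
    unfolding info by (rule integrable_mult_left)
  then show "integrable \<mu> cond_info" by simp
  have "integral\<^sup>L (measure_pmf (coded_bits m) \<Otimes>\<^sub>M (\<mu> \<Otimes>\<^sub>M noise_law N0)) ?f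
      = measure_pmf.expectation (coded_bits m) (\<lambda>bs. \<integral>hz. ?f (bs, hz) \<partial>(\<mu> \<Otimes>\<^sub>M noise_law N0))"
    by (rule all.integral_fst'[OF int, symmetric])
  also have "\<dots> = avg words (\<lambda>bs. \<integral>h. \<integral>z. bit_density N0 k bs h (h * sym bs + z) \<partial>noise_law N0 \<partial>\<mu>)"
    unfolding expectation_coded_bits by (intro avg_cong) (simp add: fst)
  also have "\<dots> = (\<integral>h. avg words (\<lambda>bs. \<integral>z. bit_density N0 k bs h (h * sym bs + z) \<partial>noise_law N0) \<partial>\<mu>)"
    by (intro integral_avg(1)[symmetric] fst)
  finally show "integral\<^sup>L (measure_pmf (coded_bits m) \<Otimes>\<^sub>M (\<mu> \<Otimes>\<^sub>M noise_law N0)) ?f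
      = (\<integral>h. cond_info h \<partial>\<mu>) / ln 2"
    unfolding info by simp
qed

lemma cond_info_expansion:
  "\<bar>cond_info h - (h * bit_mean k) \<bullet> (h * bit_mean k) / N0\<bar> \<le> 1400 * (h \<bullet> h * R / N0)\<^sup>2"
proof -
  interpret B: balanced_signals words "bit_sign k" "\<lambda>bs. h * sym bs" N0 by (rule balanced[OF k N0])
  have "B.v = h * bit_mean k"
    by (simp add: B.v_def bit_mean_def vec_eq_iff sum_distrib_left mult_ac)
  moreover have "\<bar>B.info - B.v \<bullet> B.v / N0\<bar> \<le> 1400 * (h \<bullet> h * R / N0)\<^sup>2"
  proof (rule B.info_expansion)
    fix bs assume "bs \<in> words"
    then show "(h * sym bs) \<bullet> (h * sym bs) \<le> h \<bullet> h * R / N0 * N0"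
      using inner_mult_vec_le[OF bounded, of bs h] N0 by simp
  qed
  ultimately show ?thesis by (simp add: cond_info_def)
qed

text \<open>The leading term is a combination of squared components of \<open>h\<close>, which share
  one second moment. The error is quadratic in \<open>h \<bullet> h\<close> and therefore
  integrable.\<close>

lemma expected_cond_info_expansion:
  "\<bar>(\<integral>h. cond_info h \<partial>\<mu>) - (\<integral>t. t\<^sup>2 \<partial>\<nu>) * (bit_mean k \<bullet> bit_mean k) / N0\<bar>
    \<le> 1400 * R\<^sup>2 * (\<integral>h. (h \<bullet> h)\<^sup>2 \<partial>\<mu>) / N0\<^sup>2"
proof -
  let ?w = "bit_mean k"
  have quad: "has_bochner_integral \<mu> (\<lambda>h. (h * ?w) \<bullet> (h * ?w) / N0)
      ((\<integral>t. t\<^sup>2 \<partial>\<nu>) * (?w \<bullet> ?w) / N0)"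
  proof -
    have "has_bochner_integral \<mu> (\<lambda>h. \<Sum>j\<in>UNIV. (h $ j)\<^sup>2 * (?w $ j)\<^sup>2)
        (\<Sum>j\<in>UNIV. (\<integral>t. t\<^sup>2 \<partial>\<nu>) * (?w $ j)\<^sup>2)"
      by (intro has_bochner_integral_sum has_bochner_integral_mult_left fading_moments(2)[OF fading])
    moreover have "(\<Sum>j\<in>UNIV. (h $ j)\<^sup>2 * (?w $ j)\<^sup>2) = (h * ?w) \<bullet> (h * ?w)" for h
      by (simp add: inner_vec_def power2_eq_square mult_ac)
    moreover have "(\<Sum>j\<in>UNIV. (\<integral>t. t\<^sup>2 \<partial>\<nu>) * (?w $ j)\<^sup>2) = (\<integral>t. t\<^sup>2 \<partial>\<nu>) * (?w \<bullet> ?w)"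
      by (simp add: inner_vec_def power2_eq_square sum_distrib_left)
    ultimately show ?thesis by (intro has_bochner_integral_divide_zero) simp
  qed
  have four: "has_bochner_integral \<mu> (\<lambda>h. 1400 * (h \<bullet> h * R / N0)\<^sup>2)
      (1400 * R\<^sup>2 * (\<integral>h. (h \<bullet> h)\<^sup>2 \<partial>\<mu>) / N0\<^sup>2)"
  proof -
    have "1400 * (h \<bullet> h * R / N0)\<^sup>2 = 1400 * R\<^sup>2 / N0\<^sup>2 * (h \<bullet> h)\<^sup>2" for h :: "real^'n"
      by (simp add: power_mult_distrib power_divide)
    moreover have "has_bochner_integral \<mu> (\<lambda>h. 1400 * R\<^sup>2 / N0\<^sup>2 * (h \<bullet> h)\<^sup>2)
        (1400 * R\<^sup>2 / N0\<^sup>2 * (\<integral>h. (h \<bullet> h)\<^sup>2 \<partial>\<mu>))"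
      by (intro has_bochner_integral_mult_right has_bochner_integral_integrable fading_moments(1)[OF fading])
    ultimately show ?thesis by simp
  qed
  note E = has_bochner_integral_diff[OF has_bochner_integral_integrable[OF capacity_term(1)] quad]
  have "\<bar>\<integral>h. cond_info h - (h * ?w) \<bullet> (h * ?w) / N0 \<partial>\<mu>\<bar>
      \<le> (\<integral>h. \<bar>cond_info h - (h * ?w) \<bullet> (h * ?w) / N0\<bar> \<partial>\<mu>)"
    by (rule integral_abs_bound)
  also have "\<dots> \<le> (\<integral>h. 1400 * (h \<bullet> h * R / N0)\<^sup>2 \<partial>\<mu>)"
    using E four cond_info_expansion
    by (intro integral_mono) (auto simp: has_bochner_integral_iff)
  finally show ?thesis
    using has_bochner_integral_integral_eq[OF E] has_bochner_integral_integral_eq[OF four] by simp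
qed

end

lemma capacity_expansion:
  assumes "0 < N0"
  shows "\<bar>bicm_capacity m X L \<mu> N0
      - (\<integral>t. t\<^sup>2 \<partial>\<nu>) * (\<Sum>k<m. bit_mean k \<bullet> bit_mean k) / ln 2 / N0\<bar>
    \<le> real m * (1400 * R\<^sup>2 * (\<integral>h. (h \<bullet> h)\<^sup>2 \<partial>\<mu>) / ln 2) / N0\<^sup>2"
proof -
  define c where "c k = (\<integral>h. cond_info N0 k h \<partial>\<mu>)" for k
  define q where "q k = (\<integral>t. t\<^sup>2 \<partial>\<nu>) * (bit_mean k \<bullet> bit_mean k) / N0" for k
  define K where "K = 1400 * R\<^sup>2 * (\<integral>h. (h \<bullet> h)\<^sup>2 \<partial>\<mu>) / N0\<^sup>2"
  have cq: "\<bar>c k - q k\<bar> \<le> K" if "k < m" for k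
    unfolding c_def q_def K_def by (rule expected_cond_info_expansion[OF that assms])
  have "bicm_capacity m X L \<mu> N0 = (\<Sum>k<m. \<integral>(bs, h, z). bit_density N0 k bs h (h * sym bs + z)
      \<partial>(measure_pmf (coded_bits m) \<Otimes>\<^sub>M (\<mu> \<Otimes>\<^sub>M noise_law N0)))"
    by (simp only: bicm_capacity_def bit_density_def Let_def)
  also have "\<dots> = (\<Sum>k<m. c k / ln 2)"
  proof (rule sum.cong[OF refl])
    fix k assume "k \<in> {..<m}"
    then have "k < m" by simp
    show "(\<integral>(bs, h, z). bit_density N0 k bs h (h * sym bs + z)
      \<partial>(measure_pmf (coded_bits m) \<Otimes>\<^sub>M (\<mu> \<Otimes>\<^sub>M noise_law N0))) = c k / ln 2"
      unfolding c_def by (rule capacity_term(2)[OF \<open>k < m\<close> assms])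
  qed
  finally have C: "bicm_capacity m X L \<mu> N0 = (\<Sum>k<m. c k) / ln 2"
    by (simp only: sum_divide_distrib)
  have Q: "(\<integral>t. t\<^sup>2 \<partial>\<nu>) * (\<Sum>k<m. bit_mean k \<bullet> bit_mean k) / ln 2 / N0 = (\<Sum>k<m. q k) / ln 2"
    by (simp add: q_def sum_distrib_left sum_divide_distrib[symmetric])
  have "\<bar>(\<Sum>k<m. c k) - (\<Sum>k<m. q k)\<bar> \<le> (\<Sum>k<m. \<bar>c k - q k\<bar>)"
    unfolding sum_subtractf[symmetric] by (rule sum_abs)
  also have "\<dots> \<le> real m * K"
    using sum_mono[of "{..<m}" "\<lambda>k. \<bar>c k - q k\<bar>" "\<lambda>_. K"] cq by simp
  finally have "\<bar>(\<Sum>k<m. c k) - (\<Sum>k<m. q k)\<bar> / ln 2 \<le> real m * K / ln 2"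
    by (intro divide_right_mono) auto
  then show ?thesis
    unfolding C Q diff_divide_distrib[symmetric] by (simp add: abs_divide K_def mult.commute)
qed

text \<open>\<open>capacity_expansion\<close> shows that this value satisfies the defining
  condition. For uniqueness, two coefficients would make a multiple of \<open>1 / N0\<close> of
  order \<open>1 / N0^2\<close>, so the multiple is zero.\<close>

lemma bicm_coeff_eq:
  assumes "0 < symbol_energy m X L"
  shows "bicm_coeff m X L \<mu> \<nu>
    = log 2 (exp 1) * (\<Sum>k<m. bit_mean k \<bullet> bit_mean k) / symbol_energy m X L"
proof -
  let ?e = "\<integral>t. t\<^sup>2 \<partial>\<nu>" and ?S = "\<Sum>k<m. bit_mean k \<bullet> bit_mean k"
  define K where "K = real m * (1400 * R\<^sup>2 * (\<integral>h. (h \<bullet> h)\<^sup>2 \<partial>\<mu>) / ln 2)"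
  define c where "c = ?e * symbol_energy m X L"
  define \<alpha> where "\<alpha> = log 2 (exp 1) * ?S / symbol_energy m X L"
  have e: "0 < ?e" using fading by (simp add: fading_law_def)
  have c: "0 < c" using e assms by (simp add: c_def)
  have snr: "snr m X L \<nu> N0 = c / N0" for N0 by (simp add: snr_def c_def)
  have lin: "\<alpha> * (c / N0) = ?e * ?S / ln 2 / N0" for N0
    using assms by (simp add: \<alpha>_def c_def log_def)
  have expansion: "(\<lambda>N0. bicm_capacity m X L \<mu> N0 - \<alpha> * snr m X L \<nu> N0)
      \<in> O[at_top](\<lambda>N0. (snr m X L \<nu> N0)\<^sup>2)"
  proof (rule bigoI[of _ "K / c\<^sup>2"])
    show "\<forall>\<^sub>F N0 in at_top. norm (bicm_capacity m X L \<mu> N0 - \<alpha> * snr m X L \<nu> N0)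
        \<le> K / c\<^sup>2 * norm ((snr m X L \<nu> N0)\<^sup>2)"
      using eventually_gt_at_top[of 0]
    proof eventually_elim
      case (elim N0)
      show ?case using capacity_expansion[OF elim] c
        unfolding snr lin K_def[symmetric] by (simp add: power_divide)
    qed
  qed
  show ?thesis
    unfolding bicm_coeff_def \<alpha>_def[symmetric]
  proof (rule the_equality[where P = "\<lambda>\<alpha>. (\<lambda>N0. bicm_capacity m X L \<mu> N0 - \<alpha> * snr m X L \<nu> N0)
      \<in> O[at_top](\<lambda>N0. (snr m X L \<nu> N0)\<^sup>2)", OF expansion])
    fix \<beta>
    assume "(\<lambda>N0. bicm_capacity m X L \<mu> N0 - \<beta> * snr m X L \<nu> N0) \<in> O[at_top](\<lambda>N0. (snr m X L \<nu> N0)\<^sup>2)"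
    from sum_in_bigo(2)[OF expansion this]
    have "(\<lambda>N0. (\<beta> - \<alpha>) * c / N0) \<in> O[at_top](\<lambda>N0. (c / N0)\<^sup>2)"
      by (simp add: snr algebra_simps diff_divide_distrib)
    also have "(\<lambda>N0. (c / N0)\<^sup>2) \<in> o[at_top](\<lambda>N0. 1 / N0)"
      using c by real_asymp
    finally have "((\<lambda>N0. (\<beta> - \<alpha>) * c / N0 / (1 / N0)) \<longlongrightarrow> 0) at_top"
      by (rule smalloD_tendsto)
    moreover have "((\<lambda>N0. (\<beta> - \<alpha>) * c / N0 / (1 / N0)) \<longlongrightarrow> (\<beta> - \<alpha>) * c) at_top"
      by real_asymp
    ultimately have "(\<beta> - \<alpha>) * c = 0"
      using tendsto_unique[OF trivial_limit_at_top_linorder] by blast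
    then show "\<beta> = \<alpha>" using c by simp
  qed
qed

end

section \<open>Equality in Bessel's inequality\<close>

lemma bit_sign_square: "bit_sign k bs * bit_sign k bs = 1"
  by (simp add: bit_sign_def)

text \<open>For distinct indices, flipping bit \<open>k\<close> reverses the sign of every
  product.\<close>

lemma sum_bit_sign_mult:
  assumes "k < m" "l < m"
  shows "(\<Sum>bs | length bs = m. bit_sign k bs * bit_sign l bs) = (if k = l then 2 ^ m else 0)"
proof (cases "k = l")
  case True
  then show ?thesis by (simp add: bit_sign_square card_words)
next
  case False
  have "(\<Sum>bs | length bs = m. bit_sign k bs * bit_sign l bs)
      = (\<Sum>bs | length bs = m. bit_sign k (bs[k := \<not> bs ! k]) * bit_sign l (bs[k := \<not> bs ! k]))"
    by (rule sum_words_flip[symmetric])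
  also have "\<dots> = (\<Sum>bs | length bs = m. - (bit_sign k bs * bit_sign l bs))"
    using assms False by (intro sum.cong) (auto simp: bit_sign_def)
  finally show ?thesis using False by (simp add: sum_negf)
qed

text \<open>\<open>p\<close> is the projection of \<open>x\<close> onto the first-order Walsh
  functions. The hypothesis on the \<open>w k\<close> makes the sums of
  \<open>x \<bullet> x\<close>, \<open>x \<bullet> p\<close> and \<open>p \<bullet> p\<close> all
  equal to \<open>2 ^ m\<close>, so the residual has total square zero and vanishes at every
  word.\<close>

lemma bessel_equality:
  fixes x :: "bool list \<Rightarrow> 'a::real_inner" and m :: nat
  defines "w \<equiv> \<lambda>k. (1 / 2 ^ m) *\<^sub>R (\<Sum>bs | length bs = m. bit_sign k bs *\<^sub>R x bs)"
  assumes unit: "\<And>bs. length bs = m \<Longrightarrow> x bs \<bullet> x bs = 1"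
    and eq: "(\<Sum>k<m. w k \<bullet> w k) = 1" and bs: "length bs = m"
  shows "x bs = (\<Sum>k<m. bit_sign k bs *\<^sub>R w k)"
proof -
  let ?W = "{bs :: bool list. length bs = m}"
  define p where "p bs = (\<Sum>k<m. bit_sign k bs *\<^sub>R w k)" for bs
  have w: "(\<Sum>bs\<in>?W. bit_sign k bs *\<^sub>R x bs) = 2 ^ m *\<^sub>R w k" for k
    by (simp add: w_def)
  have xx: "(\<Sum>bs\<in>?W. x bs \<bullet> x bs) = 2 ^ m"
    using unit by (simp add: card_words)
  have xp: "(\<Sum>bs\<in>?W. x bs \<bullet> p bs) = 2 ^ m"
  proof -
    have "(\<Sum>bs\<in>?W. x bs \<bullet> p bs) = (\<Sum>k<m. \<Sum>bs\<in>?W. (bit_sign k bs *\<^sub>R x bs) \<bullet> w k)"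
      unfolding p_def inner_sum_right by (subst sum.swap) simp
    also have "\<dots> = (\<Sum>k<m. 2 ^ m * (w k \<bullet> w k))"
      unfolding inner_sum_left[symmetric] w by simp
    finally show ?thesis by (simp add: sum_distrib_left[symmetric] eq)
  qed
  have pp: "(\<Sum>bs\<in>?W. p bs \<bullet> p bs) = 2 ^ m"
  proof -
    have "(\<Sum>bs\<in>?W. p bs \<bullet> p bs)
        = (\<Sum>bs\<in>?W. \<Sum>k<m. \<Sum>l<m. bit_sign k bs * bit_sign l bs * (w k \<bullet> w l))"
      unfolding p_def inner_sum_left inner_sum_right
      by (intro sum.cong refl) (simp add: sum_distrib_left mult_ac inner_commute)
    also have "\<dots> = (\<Sum>k<m. \<Sum>l<m. \<Sum>bs\<in>?W. bit_sign k bs * bit_sign l bs * (w k \<bullet> w l))"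
      by (subst sum.swap) (intro sum.cong refl sum.swap)
    also have "\<dots> = (\<Sum>k<m. \<Sum>l<m. (if k = l then 2 ^ m else 0) * (w k \<bullet> w l))"
      unfolding sum_distrib_right[symmetric]
      by (intro sum.cong refl) (simp add: sum_bit_sign_mult)
    also have "\<dots> = (\<Sum>k<m. 2 ^ m * (w k \<bullet> w k))"
      by (intro sum.cong refl) (simp add: if_distrib[of "\<lambda>c. c * _"] cong: if_cong)
    finally show ?thesis by (simp add: sum_distrib_left[symmetric] eq)
  qed
  have "(\<Sum>bs\<in>?W. (x bs - p bs) \<bullet> (x bs - p bs))
      = (\<Sum>bs\<in>?W. x bs \<bullet> x bs) - 2 * (\<Sum>bs\<in>?W. x bs \<bullet> p bs) + (\<Sum>bs\<in>?W. p bs \<bullet> p bs)"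
    by (simp add: inner_diff_left inner_diff_right inner_commute sum_subtractf sum.distrib sum_distrib_left)
  also have "\<dots> = 0" unfolding xx xp pp by simp
  finally have "\<forall>bs\<in>?W. (x bs - p bs) \<bullet> (x bs - p bs) = 0"
    by (subst (asm) sum_nonneg_eq_0_iff) (simp_all add: finite_words)
  then show ?thesis using bs by (simp add: p_def)
qed

text \<open>Setting bit \<open>k\<close> translates the point by \<open>2 *\<^sub>R w k\<close>, so
  any two bits span a parallelogram inscribed in the unit circle. Such a parallelogram is a
  rectangle, and the plane has no three nonzero orthogonal directions.\<close>

lemma no_unit_hypercube_in_plane:
  fixes x :: "bool list \<Rightarrow> real^2"
  assumes "3 \<le> m"
    and unit: "\<And>bs. length bs = m \<Longrightarrow> x bs \<bullet> x bs = 1"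
    and inj: "inj_on x {bs. length bs = m}"
    and x: "\<And>bs. length bs = m \<Longrightarrow> x bs = (\<Sum>k<m. bit_sign k bs *\<^sub>R w k)"
  shows False
proof -
  have step: "x (bs[k := True]) = x (bs[k := False]) + 2 *\<^sub>R w k" if "length bs = m" "k < m" for bs k
  proof -
    have "x (bs[k := b]) = bit_sign k (bs[k := b]) *\<^sub>R w k
        + (\<Sum>j\<in>{..<m} - {k}. bit_sign j bs *\<^sub>R w j)" for b
    proof -
      have "x (bs[k := b]) = (\<Sum>j<m. bit_sign j (bs[k := b]) *\<^sub>R w j)" using that by (simp add: x)
      also have "\<dots> = bit_sign k (bs[k := b]) *\<^sub>R w k
          + (\<Sum>j\<in>{..<m} - {k}. bit_sign j (bs[k := b]) *\<^sub>R w j)"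
        using that by (simp add: sum.remove)
      also have "(\<Sum>j\<in>{..<m} - {k}. bit_sign j (bs[k := b]) *\<^sub>R w j)
          = (\<Sum>j\<in>{..<m} - {k}. bit_sign j bs *\<^sub>R w j)"
        by (intro sum.cong) (auto simp: bit_sign_def)
      finally show ?thesis .
    qed
    from this[of True] this[of False] show ?thesis
      using that by (simp add: bit_sign_def scaleR_2)
  qed
  define u where "u = replicate m False"
  have u: "length u = m" by (simp add: u_def)
  have nz: "w k \<noteq> 0" if "k < m" for k
  proof
    assume "w k = 0"
    then have "x (u[k := True]) = x (u[k := False])" using step[OF u that] by simp
    then have "u[k := True] = u[k := False]" using inj u by (auto simp: inj_on_def)
    then have "u[k := True] ! k = u[k := False] ! k" by simp
    then show False using that u by simp
  qed
  have orth: "w k \<bullet> w l = 0" if "k < m" "l < m" "k \<noteq> l" for k l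
  proof -
    define a where "a = x (u[k := False, l := False])"
    have 1: "x (u[k := True, l := False]) = a + 2 *\<^sub>R w k"
      using step[of "u[l := False]" k] that u by (simp add: a_def list_update_swap)
    have 2: "x (u[k := False, l := True]) = a + 2 *\<^sub>R w l"
      using step[of "u[k := False]" l] that u by (simp add: a_def)
    have 3: "x (u[k := True, l := True]) = a + 2 *\<^sub>R w k + 2 *\<^sub>R w l"
      using step[of "u[k := True]" l] that u 1 by simp
    have "a \<bullet> a = 1" using unit u by (simp add: a_def)
    moreover have "(a + 2 *\<^sub>R w k) \<bullet> (a + 2 *\<^sub>R w k) = 1"
      unfolding 1[symmetric] using unit u by simp
    moreover have "(a + 2 *\<^sub>R w l) \<bullet> (a + 2 *\<^sub>R w l) = 1"
      unfolding 2[symmetric] using unit u by simp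
    moreover have "(a + 2 *\<^sub>R w k + 2 *\<^sub>R w l) \<bullet> (a + 2 *\<^sub>R w k + 2 *\<^sub>R w l) = 1"
      unfolding 3[symmetric] using unit u by simp
    \<comment> \<open>The alternating sum of the four squared norms is
      \<open>8 * (w k \<bullet> w l)\<close>.\<close>
    ultimately show ?thesis by (simp add: inner_add_left inner_add_right inner_commute)
  qed
  have m: "0 < m" "1 < m" "2 < m" using assms(1) by simp_all
  \<comment> \<open>Equal vectors would be orthogonal to themselves, hence zero; without
    distinctness the set below could have fewer than three elements.\<close>
  have distinct: "w 0 \<noteq> w 1" "w 0 \<noteq> w 2" "w 1 \<noteq> w 2"
    using orth[OF m(1,2)] orth[OF m(1,3)] orth[OF m(2,3)] nz[OF m(1)] nz[OF m(2)] nz[OF m(3)]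
    by auto
  have "independent {w 0, w 1, w 2}"
    using m nz orth by (intro pairwise_orthogonal_independent) (auto simp: pairwise_def orthogonal_def)
  then have "card {w 0, w 1, w 2} \<le> 2" using independent_bound by fastforce
  then show False using distinct by simp
qed

section \<open>Geometry of the PSK alphabet\<close>

lemma psk_unit: "psk_alphabet M i \<bullet> psk_alphabet M i = 1"
  by (simp add: psk_alphabet_def inner_vec_def sum_2 vector_2 power2_eq_square[symmetric])

lemma psk_inj: "inj_on (psk_alphabet M) {..<M}"
proof (rule inj_onI)
  fix i j assume ij: "i \<in> {..<M}" "j \<in> {..<M}" and "psk_alphabet M i = psk_alphabet M j"
  then have M: "0 < M" by auto
  let ?t = "\<lambda>i::nat. (2 * real i + 1) * pi / real M"
  have "sin (?t i) = sin (?t j) \<and> cos (?t i) = cos (?t j)"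
    using \<open>psk_alphabet M i = psk_alphabet M j\<close>
    by (simp add: psk_alphabet_def vec_eq_iff forall_2 vector_2)
  then obtain n :: int where "?t i = ?t j + 2 * pi * n"
    unfolding sin_cos_eq_iff by blast
  \<comment> \<open>The half-step offset of the angles cancels: \<open>i - j\<close> is a multiple
    of \<open>M\<close> of modulus less than \<open>M\<close>.\<close>
  then have "pi * (real i - real j) = pi * (real M * n)" using M by (simp add: field_simps)
  then have "real_of_int (int i - int j) = real_of_int (int M * n)" by simp
  then have eq: "int i - int j = int M * n" by linarith
  then have "\<bar>int M * n\<bar> < int M" using ij by auto
  then have "n = 0" using M by (simp add: abs_mult)
  then show "i = j" using eq by simp
qed

text \<open>In the complex plane the symbols are the \<open>M\<close>-th roots of unity rotated by
  \<open>pi / M\<close>, and these roots sum to zero.\<close>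

lemma psk_sum:
  assumes "1 < M"
  shows "(\<Sum>i<M. psk_alphabet M i) = 0"
proof -
  have "(\<Sum>i<M. cis ((2 * real i + 1) * pi / real M)) = cis (pi / real M) * (\<Sum>i<M. cis (2 * pi * real i / real M))"
    by (simp add: sum_distrib_left cis_mult add_divide_distrib algebra_simps)
  also have "(\<Sum>i<M. cis (2 * pi * real i / real M)) = \<Sum>{z. z ^ M = 1}"
    using assms sum.reindex_bij_betw[OF Complex.bij_betw_roots_unity[of M], of "\<lambda>z. z"] by simp
  also have "\<dots> = 0" by (rule sum_roots_unity[OF assms])
  finally have "(\<Sum>i<M. cis ((2 * real i + 1) * pi / real M)) = 0" by simp
  from arg_cong[where f = Re, OF this] arg_cong[where f = Im, OF this]
  show ?thesis by (simp add: psk_alphabet_def vec_eq_iff forall_2 vector_2)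
qed

theorem corollary19:
  fixes M m :: nat
    and L :: "nat \<Rightarrow> bool list"
    and \<mu> :: "(real^2) measure"
    and \<nu> :: "real measure"
  assumes "M = 2 ^ m" and "M > 4"
    and "fading_law \<mu> \<nu>"
    and "binary_labeling m L"
  shows "\<not> bicm_first_order_optimal m (psk_alphabet M) L \<mu> \<nu>"
proof
  let ?x = "symbol m (psk_alphabet M) L" and ?W = "{bs :: bool list. length bs = m}"
  assume foo: "bicm_first_order_optimal m (psk_alphabet M) L \<mu> \<nu>"
  \<comment> \<open>\<open>M > 4\<close> yields a third bit, one more than the dimension of the
    plane.\<close>
  have "(2::nat) ^ 2 < 2 ^ m" using assms(1,2) by simp
  then have m: "3 \<le> m" using power_strict_increasing_iff[of "2::nat" 2 m] by simp
  have bij: "bij_betw (inv_into {..<M} L) ?W {..<M}"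
    using assms(1,4) by (simp add: binary_labeling_def bij_betw_inv_into)
  have x: "?x bs = psk_alphabet M (inv_into {..<M} L bs)" for bs
    by (simp add: symbol_def assms(1))
  have unit: "?x bs \<bullet> ?x bs = 1" for bs
    unfolding x by (rule psk_unit)
  have inj: "inj_on ?x ?W"
    unfolding x using comp_inj_on[of "inv_into {..<M} L" ?W "psk_alphabet M"] psk_inj bij
    by (simp add: bij_betw_def comp_def)
  interpret bicm_channel m "psk_alphabet M" L \<mu> \<nu> 1
  proof
    show "(\<Sum>bs | length bs = m. ?x bs) = 0"
      unfolding x using psk_sum[of M] sum.reindex_bij_betw[OF bij, of "psk_alphabet M"] assms(2) by simp
  qed (use assms(3) unit in simp_all)
  have energy: "symbol_energy m (psk_alphabet M) L = 1"
    unfolding symbol_energy_def expectation_coded_bits power2_norm_eq_inner unit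
    by (rule avg_const[OF finite_words words_nonempty])
  \<comment> \<open>At unit energy the coefficient is \<open>log 2 (exp 1)\<close> times this sum,
    so optimality is equality in Bessel's inequality.\<close>
  have "(\<Sum>k<m. bit_mean k \<bullet> bit_mean k) = 1"
    using foo bicm_coeff_eq unfolding bicm_first_order_optimal_def energy by (simp add: log_def)
  then have "?x bs = (\<Sum>k<m. bit_sign k bs *\<^sub>R bit_mean k)" if "length bs = m" for bs
    using bessel_equality[of m ?x, OF unit _ that] unfolding bit_mean_def card_words by simp
  then show False by (rule no_unit_hypercube_in_plane[OF m unit inj])
qed

end
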